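(* For every cactus $G$, with maximum degree $\Delta=\Delta(G)$ and $n=|V(G)|$ vertices, $\operatorname{ch}(G^2)=\chi(G^2)$. Moreover, the common value is as follows. (i) If $\Delta\ge 4$, it is $\Delta+1$. (ii) If $\Delta=3$, it is $4$ if $G$ has no block isomorphic to the $5$-cycle $C_5$, and $5$ if $G$ has a block isomorphic to $C_5$. (iii) If $\Delta\le 2$ (so that $G$ is a path or a cycle): it is at most $3$ if $G$ is a path; and if $G$ is the cycle $C_n$ ($n\ge 3$), it is $3$ if $3\mid n$, it is $5$ if $n=5$, and it is $4$ otherwise.
   Context: Graphs are finite and simple. A cactus is a connected graph in which every edge lies on at most one cycle; equivalently, every block (maximal $2$-connected subgraph, where a single bridge edge also counts as a block) is an edge or a cycle. Paths include the one-vertex graph and the single edge. The square $G^2$ of a graph $G$ has vertex set $V(G)$, with $uv\in E(G^2)$ if and only if $1\le d_G(u,v)\le 2$, where $d_G(u,v)$ is the distance in $G$. $\chi(H)$ is the chromatic number of $H$, and $\operatorname{ch}(H)$ is its choice (list-chromatic) number: the least $k$ such that for every assignment of lists $L(v)$ with $|L(v)|\ge k$ to the vertices of $H$ there is a proper coloring of $H$ in which each vertex $v$ receives a color from $L(v)$. *)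

theory Defs
  imports "Graph_Theory.Graph_Theory"
begin

text \<open>
  A finite simple graph is a \<^locale>\<open>pair_graph\<close>: an irreflexive symmetric
  relation \<^const>\<open>parcs\<close> on the finite vertex set \<^const>\<open>pverts\<close>, so that an undirected edge
  \<open>uv\<close> is the pair of arcs \<open>(u, v)\<close>, \<open>(v, u)\<close> and the degree is the out-degree. Note that
  \<^const>\<open>Digraph_Component.connected\<close> excludes the graph without vertices.
\<close>

definition path_graph :: "nat \<Rightarrow> nat pair_pre_digraph" where
  "path_graph n =
    \<lparr> pverts = {..<n}, parcs = {(i, j). i < n \<and> j < n \<and> (j = Suc i \<or> i = Suc j)} \<rparr>"

text \<open>The following is the cycle \<open>C\<^sub>n\<close> only for \<open>n \<ge> 3\<close>.\<close>

definition cycle_graph :: "nat \<Rightarrow> nat pair_pre_digraph" where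
  "cycle_graph n =
    \<lparr> pverts = {..<n},
      parcs = {(i, j). i < n \<and> j < n \<and> (j = Suc i mod n \<or> i = Suc j mod n)} \<rparr>"

definition is_path :: "'a pair_pre_digraph \<Rightarrow> bool" where
  "is_path G \<longleftrightarrow> (\<exists>n\<ge>1. digraph_iso G (path_graph n))"

definition is_cycle :: "'a pair_pre_digraph \<Rightarrow> bool" where
  "is_cycle G \<longleftrightarrow> (\<exists>n\<ge>3. digraph_iso G (cycle_graph n))"

text \<open>
  Cycles of \<open>G\<close> are subgraphs here, not closed walks: \<^const>\<open>pre_digraph.cycle\<close> also admits
  \<open>u, v, u\<close>, and it distinguishes the rotations and reversals of a cycle.
\<close>

definition cactus :: "'a pair_pre_digraph \<Rightarrow> bool" where
  "cactus G \<longleftrightarrow> pair_graph G \<and> Digraph_Component.connected G \<and>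
    (\<forall>e\<in>parcs G. \<forall>C D.
       is_cycle C \<and> subgraph C G \<and> e \<in> parcs C \<and>
       is_cycle D \<and> subgraph D G \<and> e \<in> parcs D \<longrightarrow> C = D)"

definition two_connected :: "('a, 'b) pre_digraph \<Rightarrow> bool" where
  "two_connected H \<longleftrightarrow> graph H \<and> 3 \<le> card (verts H) \<and> Digraph_Component.connected H \<and>
    (\<forall>v\<in>verts H. Digraph_Component.connected (pre_digraph.del_vert H v))"

definition bridge :: "'a pair_pre_digraph \<Rightarrow> 'a \<Rightarrow> 'a \<Rightarrow> bool" where
  "bridge G u v \<longleftrightarrow> (u, v) \<in> parcs G \<and>
    \<not> u \<rightarrow>\<^sup>*\<^bsub>\<lparr> pverts = pverts G, parcs = parcs G - {(u, v), (v, u)} \<rparr>\<^esub> v"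

definition is_block :: "'a pair_pre_digraph \<Rightarrow> 'a pair_pre_digraph \<Rightarrow> bool" where
  "is_block G B \<longleftrightarrow> pre_digraph.max_subgraph G two_connected B \<or>
    (\<exists>u v. bridge G u v \<and> B = \<lparr> pverts = {u, v}, parcs = {(u, v), (v, u)} \<rparr>)"

definition max_degree :: "'a pair_pre_digraph \<Rightarrow> nat" where
  "max_degree G = Max (out_degree G ` pverts G)"

definition graph_dist :: "'a pair_pre_digraph \<Rightarrow> 'a \<Rightarrow> 'a \<Rightarrow> ereal" where
  "graph_dist G u v = wf_digraph.\<mu> G (\<lambda>_. 1) u v"

definition square :: "'a pair_pre_digraph \<Rightarrow> 'a pair_pre_digraph" where
  "square G =
    \<lparr> pverts = pverts G,
      parcs = {(u, v). u \<in> pverts G \<and> v \<in> pverts G \<and>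
                       1 \<le> graph_dist G u v \<and> graph_dist G u v \<le> 2} \<rparr>"

definition proper_coloring :: "'a pair_pre_digraph \<Rightarrow> ('a \<Rightarrow> nat) \<Rightarrow> bool" where
  "proper_coloring H c \<longleftrightarrow> (\<forall>u v. (u, v) \<in> parcs H \<longrightarrow> c u \<noteq> c v)"

definition colorable :: "'a pair_pre_digraph \<Rightarrow> nat \<Rightarrow> bool" where
  "colorable H k \<longleftrightarrow> (\<exists>c. proper_coloring H c \<and> (\<forall>v\<in>pverts H. c v < k))"

definition chromatic_number :: "'a pair_pre_digraph \<Rightarrow> nat" where
  "chromatic_number H = (LEAST k. colorable H k)"

text \<open>Lists are finite sets, so natural numbers as colors lose no generality for a finite graph.\<close>

definition choosable :: "'a pair_pre_digraph \<Rightarrow> nat \<Rightarrow> bool" where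
  "choosable H k \<longleftrightarrow>
    (\<forall>L :: 'a \<Rightarrow> nat set. (\<forall>v\<in>pverts H. finite (L v) \<and> k \<le> card (L v)) \<longrightarrow>
       (\<exists>c. proper_coloring H c \<and> (\<forall>v\<in>pverts H. c v \<in> L v)))"

definition choice_number :: "'a pair_pre_digraph \<Rightarrow> nat" where
  "choice_number H = (LEAST k. choosable H k)"

end

theory Submission
  imports Defs
begin

text \<open>
  The bounds from below come from cliques of the square (closed neighborhoods and 5-cycles) and, for
  cycles whose length is not divisible by 3, from the fact that a proper 3-coloring of the square
  has period 3. For the bounds from above, a cactus grows from a single vertex by attaching pendant
  edges and pendant cycles, and list colorings of the square are extended along this growth.
  A new leaf sees only a closed neighborhood; the path formed by the new vertices of a pendant cycle
  has to be colored from lists of sizes at least \<open>2, 3, 4, \<dots>, 4, 3, 2\<close> with distinct colors at its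
  ends, which can fail only for the 5-cycle. This leaves the square of \<open>C\<^sub>n\<close> with 3 dividing \<open>n\<close> and lists
  of size 3: the sum of the graph polynomial over all list colorings, weighted with Lagrange
  coefficients, is a coefficient of that polynomial and hence the same for all lists, and it is
  positive for the constant lists \<open>{0, 1, 2}\<close>.
\<close>

section \<open>List coloring squares of paths and pendant cycles\<close>

text \<open>The sizes \<open>2, 3, 4, ..., 4, 3, 2\<close> come from counting at the attaching
  vertex v. With k colors and degree of v below k, two neighbors of v lie on the new path, so at
  most k - 3 neighbors and v itself are already colored: the ends of the path lose at most k - 2
  colors, the vertices next to them only the color of v, all others nothing. From k = 4 on this
  suffices, except that the four new vertices of a pendant 5-cycle are pairwise adjacent in the
  square; there k = 5 is needed. The older part must gain no adjacency in its square, hence each new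
  piece may touch it at one vertex only; this is the invariant of the growth. For a cycle of length
  n with 3 dividing n and three colors, the sizes would be \<open>2, 2, 3, ..., 3, 2, 2\<close>, too
  short for these choices. There the graph polynomial has one factor for each vertex and each step 1
  or 2 along the cycle, so its degree 2n is that of the monomial with all exponents 2, which lists
  of size 3 can detect.\<close>

lemma ex_ne_of_card_ge_2:
  assumes "2 \<le> card A"
  shows "\<exists>x\<in>A. x \<noteq> a"
proof -
  have "\<not> A \<subseteq> {a}" using card_mono[of "{a}" A] assms by auto
  then show ?thesis by blast
qed

lemma ex_ne2_of_card_ge_3:
  assumes "3 \<le> card A"
  shows "\<exists>x\<in>A. x \<noteq> a \<and> x \<noteq> b"
proof -
  have "card {a, b} \<le> 2" by (simp add: card_insert_if)
  then have "\<not> A \<subseteq> {a, b}" using card_mono[of "{a, b}" A] assms by auto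
  then show ?thesis by blast
qed

lemma ex_ne3_of_card_ge_4:
  assumes "4 \<le> card A"
  shows "\<exists>x\<in>A. x \<noteq> a \<and> x \<noteq> b \<and> x \<noteq> c"
proof -
  have "card {a, b, c} \<le> 3" by (simp add: card_insert_if)
  then have "\<not> A \<subseteq> {a, b, c}" using card_mono[of "{a, b, c}" A] assms by auto
  then show ?thesis by blast
qed

lemma card_Diff_singleton_ge: "Suc n \<le> card A \<Longrightarrow> n \<le> card (A - {x})"
  by (cases "x \<in> A") (simp_all add: card_Diff_singleton)

text \<open>The constraints form the square of the path a, b, c, d, where only a and d may agree. A
  color common to \<open>A\<close> and \<open>D\<close> is used on both. Otherwise these lists offer
  at least four colors together, so either \<open>B\<close> has four colors too or some color z of
  \<open>A\<close> or \<open>D\<close> is missing from \<open>B\<close>; placing z at its end frees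
  b from one constraint.\<close>

lemma list_coloring_path4:
  assumes "2 \<le> card A" "3 \<le> card B" "3 \<le> card C" "2 \<le> card D"
  obtains a b c d where "a \<in> A" "b \<in> B" "c \<in> C" "d \<in> D"
    "a \<noteq> b" "a \<noteq> c" "b \<noteq> c" "b \<noteq> d" "c \<noteq> d"
proof (cases "A \<inter> D = {}")
  case False
  then obtain x where x: "x \<in> A" "x \<in> D" by blast
  obtain b where b: "b \<in> B" "b \<noteq> x" using ex_ne_of_card_ge_2[of B x] assms by auto
  obtain c where c: "c \<in> C" "c \<noteq> x" "c \<noteq> b" using ex_ne2_of_card_ge_3[of C x b] assms by auto
  show thesis using x b c by (intro that[of x b c x]) auto
next
  case disj: True
  obtain a0 d0 where ad: "a0 \<in> A" "d0 \<in> D"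
    using assms by fastforce
  show thesis
  proof (cases "4 \<le> card B")
    case True
    obtain c where c: "c \<in> C" "c \<noteq> a0" "c \<noteq> d0" using ex_ne2_of_card_ge_3[of C a0 d0] assms by auto
    obtain b where "b \<in> B" "b \<noteq> a0" "b \<noteq> c" "b \<noteq> d0" using ex_ne3_of_card_ge_4[of B a0 c d0] True by auto
    then show thesis using ad c by (intro that[of a0 b c d0]) auto
  next
    case False
    have "card (A \<union> D) = card A + card D"
      using assms disj by (intro card_Un_disjoint) (auto intro: card_ge_0_finite)
    then have "4 \<le> card (A \<union> D)" using assms by simp
    then have "\<not> A \<union> D \<subseteq> B"
      using False assms card_mono[of B "A \<union> D"] by (force intro: card_ge_0_finite)
    then obtain z where z: "z \<in> A \<union> D" "z \<notin> B" by blast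
    show thesis
    proof (cases "z \<in> A")
      case True
      obtain c where c: "c \<in> C" "c \<noteq> z" "c \<noteq> d0" using ex_ne2_of_card_ge_3[of C z d0] assms by auto
      obtain b where "b \<in> B" "b \<noteq> c" "b \<noteq> d0" using ex_ne2_of_card_ge_3[of B c d0] assms by auto
      then show thesis using ad c z True by (intro that[of z b c d0]) auto
    next
      case F: False
      obtain c where c: "c \<in> C" "c \<noteq> a0" "c \<noteq> z" using ex_ne2_of_card_ge_3[of C a0 z] assms by auto
      obtain b where "b \<in> B" "b \<noteq> c" "b \<noteq> a0" using ex_ne2_of_card_ge_3[of B c a0] assms by auto
      then show thesis using ad c z F by (intro that[of a0 b c z]) auto
    qed
  qed
qed

text \<open>This is the wheel with hub c and rim a, b, d, f: the square of the path a, b, c, d, f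
  together with the edge between its ends, as it occurs for a pendant 6-cycle. The cases make the
  hub harmless: opposite rim vertices share a color, or the hub takes a color outside both lists of
  size 2, or \<open>C\<close> is exactly the union of these two lists.\<close>

lemma list_coloring_wheel:
  assumes "2 \<le> card A0" and B: "3 \<le> card B" and C: "4 \<le> card C"
    and D: "3 \<le> card D" and "2 \<le> card F0"
  obtains a b c d f where "a \<in> A0" "b \<in> B" "c \<in> C" "d \<in> D" "f \<in> F0"
    "c \<noteq> a" "c \<noteq> b" "c \<noteq> d" "c \<noteq> f" "a \<noteq> b" "b \<noteq> d" "d \<noteq> f" "f \<noteq> a"
proof -
  \<comment> \<open>Trimming to exactly two colors matters in the last case: four colors of
    \<open>C\<close> inside \<open>A \<union> F\<close> then force \<open>A\<close> and
    \<open>F\<close> to be disjoint and \<open>C\<close> to be their union.\<close>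
  obtain A where A: "A \<subseteq> A0" "card A = 2" "finite A"
    using obtain_subset_with_card_n[OF assms(1)] by auto
  obtain F where F: "F \<subseteq> F0" "card F = 2" "finite F"
    using obtain_subset_with_card_n[OF assms(5)] by auto
    consider "A \<inter> D \<noteq> {}" | "B \<inter> F \<noteq> {}" | z where "A \<inter> D = {}" "z \<in> C" "z \<notin> A \<union> F"
      | "A \<inter> D = {}" "B \<inter> F = {}" "C \<subseteq> A \<union> F" by blast
    then show thesis
    proof cases
      case 1
      then obtain x where x: "x \<in> A" "x \<in> D" by blast
      obtain f where f: "f \<in> F" "f \<noteq> x" using ex_ne_of_card_ge_2[of F x] F by auto
      obtain b where b: "b \<in> B" "b \<noteq> x" using ex_ne_of_card_ge_2[of B x] B by auto
      obtain c where "c \<in> C" "c \<noteq> x" "c \<noteq> b" "c \<noteq> f" using ex_ne3_of_card_ge_4[of C x b f] C by auto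
      then show thesis using x f b A F by (intro that[of x b c x f]) auto
    next
      case 2
      then obtain x where x: "x \<in> B" "x \<in> F" by blast
      obtain a where a: "a \<in> A" "a \<noteq> x" using ex_ne_of_card_ge_2[of A x] A by auto
      obtain d where d: "d \<in> D" "d \<noteq> x" using ex_ne_of_card_ge_2[of D x] D by auto
      obtain c where "c \<in> C" "c \<noteq> x" "c \<noteq> a" "c \<noteq> d" using ex_ne3_of_card_ge_4[of C x a d] C by auto
      then show thesis using x a d F A by (intro that[of a x c d x]) auto
    next
      \<comment> \<open>With z on the hub, \<open>A\<close> and \<open>F\<close> stay intact and
        \<open>B\<close>, \<open>D\<close> keep at least two colors each, so a 4-cycle with lists of
        size 2 is left. Starting at f with a color missing from \<open>A\<close> or from
        \<open>D\<close>, the choices go around the rim and close up by themselves.\<close>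
      case (3 z)
      have "F \<noteq> {}" using F by auto
      show thesis
      proof (cases "F \<subseteq> A")
        case False
        then obtain f where f: "f \<in> F" "f \<notin> A" by blast
        obtain d where d: "d \<in> D" "d \<noteq> f" "d \<noteq> z" using ex_ne2_of_card_ge_3[of D f z] D by auto
        obtain b where b: "b \<in> B" "b \<noteq> d" "b \<noteq> z" using ex_ne2_of_card_ge_3[of B d z] B by auto
        obtain a where a: "a \<in> A" "a \<noteq> b" using ex_ne_of_card_ge_2[of A b] A by auto
        have "a \<noteq> f" "z \<noteq> a" "z \<noteq> f" using 3 a f by auto
        then show thesis using 3 a b d f A F by (intro that[of a b z d f]) auto
      next
        case True
        then obtain f where f: "f \<in> F" "f \<notin> D" using 3(1) \<open>F \<noteq> {}\<close> by blast
        obtain a where a: "a \<in> A" "a \<noteq> f" using ex_ne_of_card_ge_2[of A f] A by auto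
        obtain b where b: "b \<in> B" "b \<noteq> a" "b \<noteq> z" using ex_ne2_of_card_ge_3[of B a z] B by auto
        obtain d where d: "d \<in> D" "d \<noteq> b" "d \<noteq> z" using ex_ne2_of_card_ge_3[of D b z] D by auto
        have "d \<noteq> f" "z \<noteq> a" "z \<noteq> f" using 3 a d f by auto
        then show thesis using 3 a b d f A F by (intro that[of a b z d f]) auto
      qed
    next
      case 4
      have "card (A \<union> F) + card (A \<inter> F) = 4" using card_Un_Int[of A F] A F by simp
      moreover have "4 \<le> card (A \<union> F)" using card_mono[of "A \<union> F" C] 4 C A F by simp
      ultimately have "card (A \<inter> F) = 0" "card (A \<union> F) \<le> card C" using C by linarith+
      then have "A \<inter> F = {}" "C = A \<union> F" using 4 A F card_seteq[of "A \<union> F" C] by auto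
      \<comment> \<open>The hub takes a color of \<open>A\<close>. It lies neither in
        \<open>F\<close> nor in \<open>D\<close>, so only a and b have to avoid it, and a and f
        differ because their lists are disjoint.\<close>
      obtain z where z: "z \<in> A" using A by fastforce
      obtain a where a: "a \<in> A" "a \<noteq> z" using ex_ne_of_card_ge_2[of A z] A by auto
      obtain b where b: "b \<in> B" "b \<noteq> z" "b \<noteq> a" using ex_ne2_of_card_ge_3[of B z a] B by auto
      obtain f where f: "f \<in> F" using F by fastforce
      obtain d where d: "d \<in> D" "d \<noteq> b" "d \<noteq> f" using ex_ne2_of_card_ge_3[of D b f] D by auto
      have "f \<noteq> a" "f \<noteq> z" "z \<noteq> d" "z \<in> C"
        using z a f d 4 \<open>A \<inter> F = {}\<close> \<open>C = A \<union> F\<close> by auto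
      then show thesis using a b d f A F by (intro that[of a b z d f]) auto
    qed
qed

text \<open>Coloring vertex 0 costs only the next two lists a color, which turns the start
  \<open>3, 4\<close> of the remaining sizes into \<open>2, 3\<close>: the hypotheses reproduce
  themselves on a path shorter by one. The descent stops at four vertices, where no list of size 4
  is left.\<close>

lemma list_coloring_path_square:
  fixes A :: "nat \<Rightarrow> 'c set"
  assumes "4 \<le> p" "2 \<le> card (A 0)" "3 \<le> card (A 1)" "3 \<le> card (A (p - 2))" "2 \<le> card (A (p - 1))"
    and "\<And>i. 2 \<le> i \<Longrightarrow> i < p - 2 \<Longrightarrow> 4 \<le> card (A i)"
  shows "\<exists>c. (\<forall>i<p. c i \<in> A i) \<and> (\<forall>i. i + 1 < p \<longrightarrow> c i \<noteq> c (i + 1)) \<and>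
    (\<forall>i. i + 2 < p \<longrightarrow> c i \<noteq> c (i + 2))"
  using assms
proof (induction p arbitrary: A rule: dec_induct)
  case base
  have "3 \<le> card (A 2)" "2 \<le> card (A 3)" using base.prems by simp_all
  with base.prems(1,2) obtain a b c d where *: "a \<in> A 0" "b \<in> A 1" "c \<in> A 2" "d \<in> A 3"
    "a \<noteq> b" "a \<noteq> c" "b \<noteq> c" "b \<noteq> d" "c \<noteq> d"
    by (rule list_coloring_path4)
  show ?case
    by (rule exI[of _ "(\<lambda>_. d)(0 := a, 1 := b, 2 := c)"])
      (use * in \<open>auto simp: numeral_eq_Suc less_Suc_eq\<close>)
next
  case (step n)
  obtain x where x: "x \<in> A 0" using step.prems(1) by fastforce
  define A' where "A' i = A (Suc i) - (if i < 2 then {x} else {})" for i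
  have A'0: "2 \<le> card (A' 0)"
    using card_Diff_singleton_ge[of 2 "A 1" x] step.prems by (simp add: A'_def)
  have A'1: "3 \<le> card (A' 1)"
    using card_Diff_singleton_ge[of 3 "A 2" x] step.prems(5)[of 2] step.hyps
    by (simp add: A'_def numeral_2_eq_2)
  have "Suc n - 2 = Suc (n - 2)" "Suc n - 1 = Suc (n - 1)" using step.hyps by auto
  then have A'2: "3 \<le> card (A' (n - 2))" "2 \<le> card (A' (n - 1))"
    using step.prems(3,4) step.hyps by (auto simp: A'_def)
  have A'3: "4 \<le> card (A' i)" if "2 \<le> i" "i < n - 2" for i
    using step.prems(5)[of "Suc i"] that by (auto simp: A'_def)
  obtain c where c: "\<forall>i<n. c i \<in> A' i" "\<forall>i. i + 1 < n \<longrightarrow> c i \<noteq> c (i + 1)"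
    "\<forall>i. i + 2 < n \<longrightarrow> c i \<noteq> c (i + 2)"
    using step.IH[OF A'0 A'1 A'2 A'3] by blast
  have x01: "x \<noteq> c 0" "x \<noteq> c 1"
    using c(1) step.hyps by (auto simp: A'_def dest: spec[of _ 0] spec[of _ 1])
  show ?case
  proof (intro exI[of _ "case_nat x c"] conjI allI impI)
    fix i assume "i < Suc n"
    then show "case_nat x c i \<in> A i"
      using x c(1) by (cases i) (auto simp: A'_def split: if_splits)
  next
    fix i assume "i + 1 < Suc n"
    then show "case_nat x c i \<noteq> case_nat x c (i + 1)"
      using x01 c(2) by (cases i) auto
  next
    fix i assume "i + 2 < Suc n"
    then show "case_nat x c i \<noteq> case_nat x c (i + 2)"
      using x01 c(3) by (cases i) (auto simp: numeral_2_eq_2)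
  qed
qed

text \<open>For m up to 4 the new vertices are pairwise adjacent, and for m = 4 this requires the
  larger lists of the last hypothesis. For m = 5 the middle vertex sees both ends, which gives the
  wheel. From m = 6 on no inner vertex sees both ends, so these can be colored first.\<close>

lemma list_coloring_pendant_cycle:
  fixes A :: "nat \<Rightarrow> 'c set"
  assumes "2 \<le> m" "2 \<le> card (A 0)" "2 \<le> card (A (m - 1))"
    and A1: "\<And>i. 0 < i \<Longrightarrow> i < m - 1 \<Longrightarrow> 3 \<le> card (A i)"
    and A2: "\<And>i. 1 < i \<Longrightarrow> i < m - 2 \<Longrightarrow> 4 \<le> card (A i)"
    and A4: "m = 4 \<Longrightarrow> 4 \<le> card (A 1) \<and> 4 \<le> card (A 2)"
  shows "\<exists>c. (\<forall>i<m. c i \<in> A i) \<and> (\<forall>i. i + 1 < m \<longrightarrow> c i \<noteq> c (i + 1)) \<and>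
    (\<forall>i. i + 2 < m \<longrightarrow> c i \<noteq> c (i + 2)) \<and> c 0 \<noteq> c (m - 1)"
proof -
  obtain x where x: "x \<in> A 0" using assms(2) by fastforce
  obtain y where y: "y \<in> A (m - 1)" "y \<noteq> x" using ex_ne_of_card_ge_2[of "A (m - 1)" x] assms(3) by auto
  consider "m = 2" | "m = 3" | "m = 4" | "m = 5" | "6 \<le> m" using assms(1) by linarith
  then show ?thesis
  proof cases
    case 1
    show ?thesis
      by (rule exI[of _ "(\<lambda>_. y)(0 := x)"]) (use x y 1 in \<open>auto simp: numeral_eq_Suc less_Suc_eq\<close>)
  next
    case 2
    obtain z where "z \<in> A 1" "z \<noteq> x" "z \<noteq> y" using ex_ne2_of_card_ge_3[of "A 1" x y] A1[of 1] 2 by auto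
    then show ?thesis
      by (intro exI[of _ "(\<lambda>_. y)(0 := x, 1 := z)"])
        (use x y 2 in \<open>auto simp: numeral_eq_Suc less_Suc_eq\<close>)
  next
    case 3
    obtain z where z: "z \<in> A 1" "z \<noteq> x" "z \<noteq> y" using ex_ne2_of_card_ge_3[of "A 1" x y] A4 3 by auto
    obtain w where "w \<in> A 2" "w \<noteq> x" "w \<noteq> y" "w \<noteq> z" using ex_ne3_of_card_ge_4[of "A 2" x y z] A4 3 by auto
    then show ?thesis
      by (intro exI[of _ "(\<lambda>_. y)(0 := x, 1 := z, 2 := w)"])
        (use x y z 3 in \<open>auto simp: numeral_eq_Suc less_Suc_eq\<close>)
  next
    case 4
    have "3 \<le> card (A 1)" "4 \<le> card (A 2)" "3 \<le> card (A 3)"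
      using A1[of 1] A2[of 2] A1[of 3] 4 by auto
    then obtain a b c d f where "a \<in> A 0" "b \<in> A 1" "c \<in> A 2" "d \<in> A 3" "f \<in> A 4"
      "c \<noteq> a" "c \<noteq> b" "c \<noteq> d" "c \<noteq> f" "a \<noteq> b" "b \<noteq> d" "d \<noteq> f" "f \<noteq> a"
      by (rule list_coloring_wheel[OF assms(2)]) (use assms(3) 4 in auto)
    then show ?thesis
      by (intro exI[of _ "(\<lambda>_. f)(0 := a, 1 := b, 2 := c, 3 := d)"])
        (use 4 in \<open>auto simp: numeral_eq_Suc less_Suc_eq\<close>)
  next
    case 5
    define p where "p = m - 2"
    have m: "m = p + 2" "4 \<le> p" using 5 by (auto simp: p_def)
    \<comment> \<open>Since \<open>4 \<le> p\<close>, the positions 0 and 1, which lose x, are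
      distinct from the positions \<open>p - 2\<close> and \<open>p - 1\<close>, which lose y; no
      list loses both.\<close>
    define A' where "A' i = A (Suc i) - (if i < 2 then {x} else {}) - (if p - 2 \<le> i then {y} else {})"
      for i
    have "2 \<le> card (A' 0)"
      using card_Diff_singleton_ge[of 2 "A 1" x] A1[of 1] m by (simp add: A'_def)
    moreover have "3 \<le> card (A' 1)"
      using card_Diff_singleton_ge[of 3 "A 2" x] A2[of 2] m by (simp add: A'_def numeral_2_eq_2)
    moreover have "3 \<le> card (A' (p - 2))"
      using card_Diff_singleton_ge[of 3 "A (Suc (p - 2))" y] A2[of "Suc (p - 2)"] m
      by (simp add: A'_def)
    moreover have "2 \<le> card (A' (p - 1))"
      using card_Diff_singleton_ge[of 2 "A (Suc (p - 1))" y] A1[of "Suc (p - 1)"] m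
      by (simp add: A'_def) linarith
    moreover have "4 \<le> card (A' i)" if "2 \<le> i" "i < p - 2" for i
      using A2[of "Suc i"] that m by (simp add: A'_def)
    ultimately obtain c where c: "\<forall>i<p. c i \<in> A' i" "\<forall>i. i + 1 < p \<longrightarrow> c i \<noteq> c (i + 1)"
      "\<forall>i. i + 2 < p \<longrightarrow> c i \<noteq> c (i + 2)"
      using list_coloring_path_square[OF m(2), of A'] by blast
    have xc: "x \<noteq> c 0" "x \<noteq> c 1"
      using c(1) m by (auto simp: A'_def dest: spec[of _ 0] spec[of _ 1])
    have yc: "c i \<noteq> y" if "i < p" "p - 2 \<le> i" for i
      using c(1) that by (auto simp: A'_def)
    define c' where "c' i = (if i = 0 then x else if i = p + 1 then y else c (i - 1))" for i
    show ?thesis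
    proof (intro exI[of _ c'] conjI allI impI)
      fix i assume "i < m"
      then show "c' i \<in> A i"
        using x y c(1)[rule_format, of "i - 1"] m by (auto simp: c'_def A'_def)
    next
      fix i assume i: "i + 1 < m"
      show "c' i \<noteq> c' (i + 1)"
        using xc yc[of "p - 1"] y c(2)[rule_format, of "i - 1"] m i
        by (cases i) (auto simp: c'_def)
    next
      fix i assume i: "i + 2 < m"
      show "c' i \<noteq> c' (i + 2)"
        using xc yc[of "p - 2"] y c(3)[rule_format, of "i - 1"] m i
        by (cases i) (auto simp: c'_def)
    next
      show "c' 0 \<noteq> c' (m - 1)" using y m by (auto simp: c'_def)
    qed
  qed
qed

section \<open>Growing a cactus\<close>

definition walk_list :: "'a rel \<Rightarrow> 'a list \<Rightarrow> bool" where
  "walk_list E = successively (\<lambda>a b. (a, b) \<in> E)"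

lemma walk_list_simps [simp]:
  "walk_list E []" "walk_list E [a]"
  "walk_list E (a # b # xs) \<longleftrightarrow> (a, b) \<in> E \<and> walk_list E (b # xs)"
  by (simp_all add: walk_list_def)

lemma walk_list_append:
  "walk_list E (xs @ ys) \<longleftrightarrow> walk_list E xs \<and> walk_list E ys \<and>
    (xs \<noteq> [] \<longrightarrow> ys \<noteq> [] \<longrightarrow> (last xs, hd ys) \<in> E)"
  by (auto simp: walk_list_def successively_append_iff)

lemma walk_list_Cons:
  "walk_list E (x # xs) \<longleftrightarrow> walk_list E xs \<and> (xs \<noteq> [] \<longrightarrow> (x, hd xs) \<in> E)"
  by (cases xs) auto

lemma walk_list_rev: "sym E \<Longrightarrow> walk_list E (rev xs) \<longleftrightarrow> walk_list E xs"
proof -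
  assume "sym E"
  then have "(b, a) \<in> E \<longleftrightarrow> (a, b) \<in> E" for a b by (auto elim: symE)
  then show ?thesis by (simp add: walk_list_def)
qed

lemma walk_list_mono: "walk_list E xs \<Longrightarrow> E \<subseteq> F \<Longrightarrow> walk_list F xs"
  by (auto simp: walk_list_def elim: successively_mono)

lemma walk_list_nth: "walk_list E xs \<longleftrightarrow> (\<forall>i. Suc i < length xs \<longrightarrow> (xs ! i, xs ! Suc i) \<in> E)"
  by (simp add: walk_list_def successively_conv_nth)

lemma walk_list_rtrancl: "walk_list E xs \<Longrightarrow> xs \<noteq> [] \<Longrightarrow> (hd xs, last xs) \<in> E\<^sup>*"
  by (induction xs rule: induct_list012) (auto intro: converse_rtrancl_into_rtrancl)

lemma rtrancl_distinct_walk_list: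
  assumes "(x, y) \<in> E\<^sup>*"
  obtains p where "walk_list E p" "p \<noteq> []" "hd p = x" "last p = y" "distinct p"
proof -
  have "\<exists>p. walk_list E p \<and> p \<noteq> [] \<and> hd p = x \<and> last p = y \<and> distinct p"
    using assms
  proof (induction rule: rtrancl_induct)
    case base
    then show ?case by (intro exI[of _ "[x]"]) auto
  next
    case (step y z)
    then obtain p where p: "walk_list E p" "p \<noteq> []" "hd p = x" "last p = y" "distinct p" by blast
    show ?case
    proof (cases "z \<in> set p")
      case True
      then obtain as bs where "p = as @ z # bs" by (auto dest: split_list)
      then show ?thesis using p
        by (intro exI[of _ "as @ [z]"]) (auto simp: walk_list_append hd_append)
    next
      case False
      then show ?thesis using p step.hyps
        by (intro exI[of _ "p @ [z]"]) (auto simp: walk_list_append)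
    qed
  qed
  then show thesis using that by blast
qed

text \<open>The closing arc runs from the last vertex to the first, and the length bound excludes an
  edge run back and forth. One cycle has several such lists, differing in start and
  direction.\<close>

definition cycle_list :: "'a rel \<Rightarrow> 'a list \<Rightarrow> bool" where
  "cycle_list E xs \<longleftrightarrow> 3 \<le> length xs \<and> distinct xs \<and> walk_list E xs \<and> (last xs, hd xs) \<in> E"

text \<open>For symmetric \<open>E\<close> and vertices outside \<open>S\<close>, its reflexive
  transitive closure means lying in the same component after deletion of \<open>S\<close>.\<close>

definition outside :: "'a rel \<Rightarrow> 'a set \<Rightarrow> 'a rel" where
  "outside E S = E \<inter> (- S) \<times> (- S)"

lemma outside_anti_mono: "S \<subseteq> T \<Longrightarrow> (outside E T)\<^sup>* \<subseteq> (outside E S)\<^sup>*"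
  by (intro rtrancl_mono) (auto simp: outside_def)

lemma sym_outside_rtrancl: "sym E \<Longrightarrow> sym ((outside E S)\<^sup>*)"
  by (intro sym_rtrancl) (unfold outside_def sym_def, blast)

lemma walk_list_outside:
  "walk_list E xs \<Longrightarrow> set xs \<inter> S = {} \<Longrightarrow> walk_list (outside E S) xs"
  by (induction xs rule: induct_list012) (auto simp: outside_def)

lemma outside_walk_list_disjoint:
  "walk_list (outside E S) xs \<Longrightarrow> hd xs \<notin> S \<Longrightarrow> set xs \<inter> S = {}"
  by (induction xs rule: induct_list012) (auto simp: outside_def)

text \<open>Every component of the graph outside \<open>S\<close> is attached to \<open>S\<close> at a single vertex.\<close>

definition separated :: "'a rel \<Rightarrow> 'a set \<Rightarrow> bool" where
  "separated E S \<longleftrightarrow> (\<forall>u\<in>S. \<forall>u'\<in>S. \<forall>x y. x \<notin> S \<longrightarrow> y \<notin> S \<longrightarrow> (u, x) \<in> E \<longrightarrow>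
    (x, y) \<in> (outside E S)\<^sup>* \<longrightarrow> (y, u') \<in> E \<longrightarrow> u = u')"

lemma separatedD:
  "separated E S \<Longrightarrow> u \<in> S \<Longrightarrow> u' \<in> S \<Longrightarrow> x \<notin> S \<Longrightarrow> y \<notin> S \<Longrightarrow> (u, x) \<in> E \<Longrightarrow>
    (x, y) \<in> (outside E S)\<^sup>* \<Longrightarrow> (y, u') \<in> E \<Longrightarrow> u = u'"
  unfolding separated_def by blast

lemma nth_split2:
  assumes "i < j" "j < length zs"
  obtains ps as bs where "zs = ps @ zs ! i # as @ zs ! j # bs" "length ps = i"
    "length as = j - Suc i" "length bs = length zs - Suc j"
proof
  have "zs = take j zs @ zs ! j # drop (Suc j) zs" using assms by (simp add: id_take_nth_drop)
  moreover have "take j zs = take i zs @ zs ! i # drop (Suc i) (take j zs)"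
    using assms id_take_nth_drop[of i "take j zs"] by (simp add: min_def)
  ultimately show "zs = take i zs @ zs ! i # drop (Suc i) (take j zs) @ zs ! j # drop (Suc j) zs"
    by (metis append.assoc append_Cons)
qed (use assms in auto)

text \<open>\<open>unique_cycle\<close> says that an edge lies on at most one cycle: the edge ab
  closes the paths through \<open>as\<close> and \<open>bs\<close> to cycles. Comparing sets of
  inner vertices makes the condition independent of the start and direction of a cycle.\<close>

locale cactus_relation =
  fixes V :: "'a set" and E :: "'a rel"
  assumes finite_V: "finite V"
    and E_subset: "E \<subseteq> V \<times> V"
    and sym_E: "sym E"
    and irrefl_E: "(a, a) \<notin> E"
    and connected_E: "a \<in> V \<Longrightarrow> b \<in> V \<Longrightarrow> (a, b) \<in> E\<^sup>*"
    and unique_cycle: "(a, b) \<in> E \<Longrightarrow> as \<noteq> [] \<Longrightarrow> bs \<noteq> [] \<Longrightarrow>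
      walk_list E (a # as @ [b]) \<Longrightarrow> walk_list E (a # bs @ [b]) \<Longrightarrow>
      distinct (a # as @ [b]) \<Longrightarrow> distinct (a # bs @ [b]) \<Longrightarrow> set as = set bs"
begin

lemma E_sym: "(a, b) \<in> E \<Longrightarrow> (b, a) \<in> E"
  using sym_E by (rule symD)

text \<open>The first edge ua of the nonempty path lies on two cycles: from u along
  \<open>bs\<close>, or along \<open>cs\<close>, to w and then back along the first path to a.
  Uniqueness makes their vertex sets equal, but \<open>bs\<close> and \<open>cs\<close> are disjoint
  and not both empty.\<close>

lemma no_theta:
  assumes "walk_list E (u # as @ [w])" "walk_list E (u # bs @ [w])" "walk_list E (u # cs @ [w])"
    and "distinct (u # w # as @ bs @ cs)" and "as \<noteq> []" and "bs \<noteq> [] \<or> cs \<noteq> []"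
  shows False
proof -
  obtain a as' where as: "as = a # as'" using assms(5) by (cases as) auto
  have *: "walk_list E (u # (ds @ w # rev as') @ [a])"
    if "walk_list E (u # ds @ [w])" for ds
  proof -
    have "walk_list E (a # as' @ [w])" using assms(1) as by simp
    then have "walk_list E (rev (a # as' @ [w]))" using walk_list_rev[OF sym_E] by blast
    then have "walk_list E ((w # rev as') @ [a])" by simp
    moreover have "walk_list E ((u # ds) @ [w])" using that by simp
    ultimately have "walk_list E ((u # ds) @ ((w # rev as') @ [a]))"
      unfolding walk_list_append[of E "u # ds"] by simp
    then show ?thesis by simp
  qed
  have ua: "(u, a) \<in> E" using assms(1) as by simp
  have d: "distinct (u # (bs @ w # rev as') @ [a])" "distinct (u # (cs @ w # rev as') @ [a])"
    using assms(4) as by auto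
  have "set (bs @ w # rev as') = set (cs @ w # rev as')"
    by (rule unique_cycle[OF ua _ _ *[OF assms(2)] *[OF assms(3)] d]) simp_all
  moreover have "set bs = set (bs @ w # rev as') - insert w (set as')"
    "set cs = set (cs @ w # rev as') - insert w (set as')"
    using assms(4) as by auto
  ultimately have "set bs = set cs" by (simp only:)
  moreover have "set bs \<inter> set cs = {}" using assms(4) by simp
  ultimately show False using assms(6) by simp
qed

text \<open>A cycle with an ear is a theta graph: its three paths are the two arcs of the cycle
  between u and w and the ear. The last hypothesis rules out that the ear is just an edge of the
  cycle.\<close>

lemma no_cycle_ear:
  assumes "cycle_list E (ps @ u # as @ w # bs)" and "walk_list E (u # qs @ [w])"
    and "distinct qs" and "set qs \<inter> set (ps @ u # as @ w # bs) = {}"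
    and "as \<noteq> [] \<and> ps @ bs \<noteq> [] \<or> qs \<noteq> []"
  shows False
proof -
  let ?zs = "ps @ u # as @ w # bs"
  have c: "walk_list E ?zs" "(last ?zs, hd ?zs) \<in> E" "distinct ?zs" "3 \<le> length ?zs"
    using assms(1) by (auto simp: cycle_list_def)
  have wa: "walk_list E (u # as @ [w])"
  proof -
    have "walk_list E (ps @ (u # as @ [w]) @ bs)" using c(1) by simp
    then show ?thesis unfolding walk_list_append[of E ps] walk_list_append[of E "u # as @ [w]"] by blast
  qed
  \<comment> \<open>The second arc of the cycle runs from u backwards through \<open>ps\<close>,
    over the closing arc, and backwards through \<open>bs\<close> to w.\<close>
  have "walk_list E (u # (rev ps @ rev bs) @ [w])"
  proof -
    have "walk_list E ((ps @ [u]) @ as @ (w # bs))" using c(1) by simp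
    then have "walk_list E (ps @ [u])" "walk_list E (w # bs)"
      unfolding walk_list_append[of E "ps @ [u]"] walk_list_append[of E as] by blast+
    then have "walk_list E (rev (ps @ [u]))" "walk_list E (rev (w # bs))"
      using walk_list_rev[OF sym_E] by blast+
    then have "walk_list E (u # rev ps)" "walk_list E (rev bs @ [w])" by auto
    moreover have "(last (u # rev ps), hd (rev bs @ [w])) \<in> E"
      using E_sym[OF c(2)] by (cases ps; cases bs rule: rev_cases) (auto simp: last_rev)
    ultimately have "walk_list E ((u # rev ps) @ (rev bs @ [w]))"
      unfolding walk_list_append[of E "u # rev ps"] by simp
    then show ?thesis by simp
  qed
  note wb = this
  have d: "distinct (u # w # as @ (rev ps @ rev bs) @ qs)" using c(3) assms(3,4) by auto
  show False
  proof (cases "as = []")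
    case False
    then show ?thesis using no_theta[OF wa wb assms(2) d] assms(5) by auto
  next
    case True
    then have "rev ps @ rev bs \<noteq> []" using c(4) by auto
    moreover have "distinct (u # w # (rev ps @ rev bs) @ as @ qs)" using d by auto
    ultimately show ?thesis using no_theta[OF wb wa assms(2)] True assms(5) by blast
  qed
qed

text \<open>A chord would be an ear without inner vertices. The second alternative is the closing
  arc.\<close>

lemma cycle_chordless:
  assumes "cycle_list E zs" "i < j" "j < length zs" "(zs ! i, zs ! j) \<in> E"
  shows "j = Suc i \<or> i = 0 \<and> Suc j = length zs"
proof (rule ccontr)
  assume *: "\<not> ?thesis"
  obtain ps as bs where s: "zs = ps @ zs ! i # as @ zs ! j # bs" "length ps = i"
    "length as = j - Suc i" "length bs = length zs - Suc j"
    using nth_split2[OF assms(2,3)] by blast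
  show False
    by (rule no_cycle_ear[of ps "zs ! i" as "zs ! j" bs "[]"]) (use s * assms in auto)
qed

text \<open>A component outside the cycle that touches it at two vertices contains an ear; by
  symmetry the contact with the smaller position may be taken as its start.\<close>

lemma separated_cycle:
  assumes "cycle_list E zs"
  shows "separated E (set zs)"
  unfolding separated_def
proof (intro ballI allI impI, rule ccontr)
  have *: False if h: "i < j" "j < length zs" "x \<notin> set zs" "y \<notin> set zs" "(zs ! i, x) \<in> E"
    "(x, y) \<in> (outside E (set zs))\<^sup>*" "(y, zs ! j) \<in> E" for i j x y
  proof -
    obtain ps as bs where s: "zs = ps @ zs ! i # as @ zs ! j # bs"
      using nth_split2[OF h(1,2)] by metis
    obtain qs where qs: "walk_list (outside E (set zs)) qs" "qs \<noteq> []" "hd qs = x" "last qs = y"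
      "distinct qs"
      using rtrancl_distinct_walk_list[OF h(6)] by blast
    have "set qs \<inter> set zs = {}" using outside_walk_list_disjoint[OF qs(1)] qs h by auto
    moreover have "walk_list E qs" using walk_list_mono[OF qs(1)] by (auto simp: outside_def)
    then have "walk_list E (zs ! i # qs @ [zs ! j])"
      using qs h by (auto simp: walk_list_append walk_list_Cons)
    ultimately show False
      using no_cycle_ear[of ps "zs ! i" as "zs ! j" bs qs] s assms qs by (metis (no_types))
  qed
  fix u u' x y
  assume a: "u \<in> set zs" "u' \<in> set zs" "x \<notin> set zs" "y \<notin> set zs" "(u, x) \<in> E"
    "(x, y) \<in> (outside E (set zs))\<^sup>*" "(y, u') \<in> E" "u \<noteq> u'"
  have "(y, x) \<in> (outside E (set zs))\<^sup>*" using sym_outside_rtrancl[OF sym_E] a(6) by (rule symD)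
  moreover obtain i j where "i < length zs" "u = zs ! i" "j < length zs" "u' = zs ! j"
    using a by (metis in_set_conv_nth)
  moreover from this have "i < j \<or> j < i" using a by (cases i j rule: linorder_cases) auto
  ultimately show False using *[of i j x y] *[of j i y x] a E_sym by blast
qed

text \<open>Only a component touching both w and some u in \<open>S\<close> could break separation.
  Since w itself lay outside \<open>S\<close> before, u must be v, and a path through the component
  then closes with the edge vw to a cycle, which is excluded.\<close>

lemma separated_insert:
  assumes sep: "separated E S" and v: "v \<in> S" "w \<notin> S" "(v, w) \<in> E"
    and no_cycle: "\<And>p. cycle_list E (v # p) \<Longrightarrow> last p \<noteq> w"
  shows "separated E (insert w S)"
proof -
  let ?S = "insert w S"
  have sub: "(outside E ?S)\<^sup>* \<subseteq> (outside E S)\<^sup>*" by (rule outside_anti_mono) auto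
  have *: False if u: "u \<in> S" "x \<notin> ?S" "y \<notin> ?S" "(u, x) \<in> E" "(x, y) \<in> (outside E ?S)\<^sup>*"
    "(y, w) \<in> E" for u x y
  proof -
    have "(y, w) \<in> outside E S" using that v by (auto simp: outside_def)
    then have "(x, w) \<in> (outside E S)\<^sup>*" using that(5) sub by (meson rtrancl.simps subsetD)
    then have "u = v" using separatedD[OF sep, of u v x w] u v E_sym by auto
    obtain qs where qs: "walk_list (outside E ?S) qs" "qs \<noteq> []" "hd qs = x" "last qs = y"
      "distinct qs"
      using rtrancl_distinct_walk_list[OF u(5)] by blast
    have "set qs \<inter> ?S = {}" using outside_walk_list_disjoint[OF qs(1)] qs u by auto
    moreover have "walk_list E qs" using walk_list_mono[OF qs(1)] by (auto simp: outside_def)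
    moreover have "3 \<le> length (v # qs @ [w])" using qs(2) by (cases qs) auto
    ultimately have "cycle_list E (v # qs @ [w])"
      using qs u v \<open>u = v\<close> E_sym by (auto simp: cycle_list_def walk_list_append walk_list_Cons)
    then show False using no_cycle[of "qs @ [w]"] by simp
  qed
  have so: "sym ((outside E ?S)\<^sup>*)"
    using sym_E by (rule sym_outside_rtrancl)
  show ?thesis
    unfolding separated_def
  proof (intro ballI allI impI)
    fix u u' x y
    assume a: "u \<in> ?S" "u' \<in> ?S" "x \<notin> ?S" "y \<notin> ?S" "(u, x) \<in> E"
      "(x, y) \<in> (outside E ?S)\<^sup>*" "(y, u') \<in> E"
    show "u = u'"
    proof (cases "u = w")
      case True
      have "u' \<notin> S"
        using *[OF _ a(4,3) E_sym[OF a(7)] symD[OF so a(6)]] E_sym[OF a(5)] True by blast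
      then show ?thesis using a(2) True by blast
    next
      case False
      then have "u \<in> S" using a(1) by blast
      then have "u' \<noteq> w" using *[OF _ a(3-6)] a(7) by blast
      then have "u' \<in> S" using a(2) by blast
      then show ?thesis
        using separatedD[OF sep \<open>u \<in> S\<close> _ _ _ a(5) subsetD[OF sub a(6)] a(7)] a(3,4) by blast
    qed
  qed
qed

text \<open>The critical component touches \<open>S\<close> at u and the new vertices at u'. From u'
  the rest of the cycle leads outside \<open>S\<close> to its last vertex, a neighbor of v, so u =
  v. Then both contacts lie on the cycle, which is itself separated.\<close>

lemma separated_Un_cycle:
  assumes sep: "separated E S" and v: "v \<in> S" and cyc: "cycle_list E (v # xs)"
    and disj: "set xs \<inter> S = {}"
  shows "separated E (S \<union> set xs)"
proof -
  let ?S = "S \<union> set xs"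
  have sub: "(outside E ?S)\<^sup>* \<subseteq> (outside E S)\<^sup>*" "(outside E ?S)\<^sup>* \<subseteq> (outside E (set (v # xs)))\<^sup>*"
    using v by (auto intro!: outside_anti_mono)
  have xs: "walk_list E xs" "(last xs, v) \<in> E" "xs \<noteq> []"
    using cyc by (auto simp: cycle_list_def walk_list_Cons split: if_splits)
  have *: "u = v" if u: "u \<in> S" "u' \<in> set xs" "x \<notin> ?S" "y \<notin> ?S" "(u, x) \<in> E"
    "(x, y) \<in> (outside E ?S)\<^sup>*" "(y, u') \<in> E" for u u' x y
  proof -
    obtain ps qs where p: "xs = ps @ u' # qs" using u(2) by (auto dest: split_list)
    then have "walk_list E (u' # qs)" using xs by (auto simp: walk_list_append)
    then have "walk_list (outside E S) (u' # qs)" using disj p by (intro walk_list_outside) auto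
    then have "(u', last xs) \<in> (outside E S)\<^sup>*" using walk_list_rtrancl p by fastforce
    moreover have "(y, u') \<in> outside E S" using u disj by (auto simp: outside_def)
    ultimately have "(x, last xs) \<in> (outside E S)\<^sup>*" using subsetD[OF sub(1) u(6)]
      by (meson converse_rtrancl_into_rtrancl rtrancl_trans)
    moreover have "last xs \<notin> S" using xs disj by (auto dest: last_in_set)
    ultimately show ?thesis using separatedD[OF sep u(1) v, of x "last xs"] u xs by auto
  qed
  have so: "sym ((outside E ?S)\<^sup>*)"
    using sym_E by (rule sym_outside_rtrancl)
  show ?thesis
    unfolding separated_def
  proof (intro ballI allI impI)
    fix u u' x y
    assume a: "u \<in> ?S" "u' \<in> ?S" "x \<notin> ?S" "y \<notin> ?S" "(u, x) \<in> E"
      "(x, y) \<in> (outside E ?S)\<^sup>*" "(y, u') \<in> E"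
    have yx: "(y, x) \<in> (outside E ?S)\<^sup>*" using so a(6) by (rule symD)
    have c: "u = u'" if "u \<in> set (v # xs)" "u' \<in> set (v # xs)"
      using separatedD[OF separated_cycle[OF cyc] that _ _ a(5) subsetD[OF sub(2) a(6)] a(7)] a(3,4) v
      by auto
    show "u = u'"
    proof (cases "u \<in> S"; cases "u' \<in> S")
      assume "u \<in> S" "u' \<in> S"
      then show ?thesis
        using separatedD[OF sep _ _ _ _ a(5) subsetD[OF sub(1) a(6)] a(7)] a(3,4) by blast
    next
      assume "u \<in> S" "u' \<notin> S"
      then show ?thesis using *[OF _ _ a(3-7)] c a(2) by auto
    next
      assume "u \<notin> S" "u' \<in> S"
      then show ?thesis using *[OF _ _ a(4,3) E_sym[OF a(7)] yx E_sym[OF a(5)]] c a(1) by auto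
    next
      assume "u \<notin> S" "u' \<notin> S"
      then show ?thesis using c a(1,2) by auto
    qed
  qed
qed

text \<open>Beyond the last vertex z of \<open>xs\<close> in \<open>S\<close> the cycle stays
  outside \<open>S\<close> until it returns to v, so separation gives z = v, contrary to
  distinctness.\<close>

lemma pendant_cycle_disjoint:
  assumes sep: "separated E S" and v: "v \<in> S" "last xs \<notin> S" and cyc: "cycle_list E (v # xs)"
  shows "set xs \<inter> S = {}"
proof (rule ccontr)
  assume "set xs \<inter> S \<noteq> {}"
  then have "\<exists>z\<in>set xs. z \<in> S" by auto
  then obtain ys z zs where z: "xs = ys @ z # zs" "z \<in> S" "\<forall>y\<in>set zs. y \<notin> S"
    by (rule split_list_last_propE[of xs "\<lambda>z. z \<in> S"])
  have xs: "walk_list E xs" "(last xs, v) \<in> E"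
    using cyc by (auto simp: cycle_list_def walk_list_Cons split: if_splits)
  have zs: "zs \<noteq> []" using z v by auto
  then have w: "walk_list E zs" "(z, hd zs) \<in> E"
    using xs(1) z by (auto simp: walk_list_append walk_list_Cons)
  have "walk_list (outside E S) zs" using w z by (intro walk_list_outside) auto
  then have "(hd zs, last zs) \<in> (outside E S)\<^sup>*" using zs by (rule walk_list_rtrancl)
  then have "z = v"
    using separatedD[OF sep z(2) v(1), of "hd zs" "last zs"] w zs xs z by auto
  then show False using cyc z by (auto simp: cycle_list_def)
qed

text \<open>By connectivity some edge vw leaves \<open>S\<close> as long as
  \<open>S \<noteq> V\<close>. It is added alone if no cycle passes through it, and otherwise
  together with its whole cycle, since the remainder of a partly added cycle would touch the new set
  twice. That the new piece is induced and touches only v follows from \<open>separated\<close> and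
  the absence of chords.\<close>

lemma cactus_induct:
  assumes r: "r \<in> V" "P {r}"
    and edge: "\<And>S v w. S \<subseteq> V \<Longrightarrow> v \<in> S \<Longrightarrow> w \<in> V - S \<Longrightarrow> (v, w) \<in> E \<Longrightarrow>
      (\<And>u. u \<in> S \<Longrightarrow> (u, w) \<in> E \<Longrightarrow> u = v) \<Longrightarrow> P S \<Longrightarrow> P (insert w S)"
    and cyc: "\<And>S v xs. S \<subseteq> V \<Longrightarrow> v \<in> S \<Longrightarrow> set xs \<subseteq> V - S \<Longrightarrow> cycle_list E (v # xs) \<Longrightarrow>
      (\<And>u i. u \<in> S \<Longrightarrow> i < length xs \<Longrightarrow> (u, xs ! i) \<in> E \<Longrightarrow>
        u = v \<and> (i = 0 \<or> Suc i = length xs)) \<Longrightarrow>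
      (\<And>i j. i < j \<Longrightarrow> j < length xs \<Longrightarrow> (xs ! i, xs ! j) \<in> E \<Longrightarrow> j = Suc i) \<Longrightarrow>
      P S \<Longrightarrow> P (S \<union> set xs)"
  shows "P V"
proof -
  have "P V" if "S \<subseteq> V" "r \<in> S" "separated E S" "P S" for S
    using that
  proof (induction "card (V - S)" arbitrary: S rule: less_induct)
    case less
    have fS: "finite (V - S)" using finite_V by auto
    show ?case
    proof (cases "S = V")
      case False
      have "\<exists>v w. v \<in> S \<and> w \<in> V - S \<and> (v, w) \<in> E"
      proof (rule ccontr)
        assume *: "\<not> ?thesis"
        obtain z where z: "z \<in> V" "z \<notin> S" using False less.prems by auto
        have "(r, z) \<in> E\<^sup>*" using connected_E r z by auto
        then have "z \<in> S"
          by (induction rule: rtrancl_induct) (use * less.prems E_subset in auto)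
        then show False using z by simp
      qed
      then obtain v w where v: "v \<in> S" "w \<in> V - S" "(v, w) \<in> E" by blast
      show ?thesis
      proof (cases "\<exists>p. cycle_list E (v # p) \<and> last p = w")
        case False
        have "P (insert w S)"
        proof (rule edge[OF less.prems(1) v _ less.prems(4)])
          show "u = v" if "u \<in> S" "(u, w) \<in> E" for u
            using separatedD[OF less.prems(3) that(1) v(1) _ _ that(2) rtrancl_refl E_sym[OF v(3)]] v(2)
            by blast
        qed
        moreover have "separated E (insert w S)"
          using separated_insert[OF less.prems(3) v(1) _ v(3)] v(2) False by blast
        moreover have "card (V - insert w S) < card (V - S)"
          using v fS by (intro psubset_card_mono) auto
        moreover have "insert w S \<subseteq> V" "r \<in> insert w S" using less.prems v by auto
        ultimately show ?thesis using less.hyps by blast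
      next
        case True
        then obtain xs where xs: "cycle_list E (v # xs)" "last xs = w" by blast
        have disj: "set xs \<inter> S = {}"
          using pendant_cycle_disjoint[OF less.prems(3) v(1) _ xs(1)] xs v by auto
        have w: "walk_list E (v # xs)" "xs \<noteq> []" "walk_list E xs" "(last xs, v) \<in> E"
          using xs by (auto simp: cycle_list_def walk_list_Cons split: if_splits)
        have xsV: "set xs \<subseteq> V"
        proof
          fix z assume "z \<in> set xs"
          then obtain i where "i < length xs" "z = xs ! i" by (metis in_set_conv_nth)
          then show "z \<in> V" using w(1) E_subset unfolding walk_list_nth by fastforce
        qed
        have "P (S \<union> set xs)"
        proof (rule cyc[OF less.prems(1) v(1) _ xs(1)])
          show "set xs \<subseteq> V - S" using xsV disj by auto
          show "P S" by (rule less.prems(4))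
          \<comment> \<open>Positions in \<open>xs\<close> are shifted by one against the cycle
            \<open>v # xs\<close>, in which v has position 0.\<close>
          show "j = Suc i" if "i < j" "j < length xs" "(xs ! i, xs ! j) \<in> E" for i j
            using cycle_chordless[OF xs(1), of "Suc i" "Suc j"] that by auto
          show "u = v \<and> (i = 0 \<or> Suc i = length xs)"
            if u: "u \<in> S" "i < length xs" "(u, xs ! i) \<in> E" for u i
          proof -
            have "walk_list E (drop i xs)" using w(3) by (metis append_take_drop_id walk_list_append)
            moreover have "set (drop i xs) \<inter> S = {}" using disj set_drop_subset[of i xs] by auto
            ultimately have "walk_list (outside E S) (drop i xs)" by (rule walk_list_outside)
            then have "(xs ! i, last xs) \<in> (outside E S)\<^sup>*"
              using walk_list_rtrancl[of _ "drop i xs"] u by (auto simp: hd_drop_conv_nth)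
            then have "u = v"
              using separatedD[OF less.prems(3) u(1) v(1) _ _ u(3) _ w(4)] u(2) v(2) xs(2) disj
              by (metis DiffD2 disjoint_iff nth_mem)
            then show ?thesis using cycle_chordless[OF xs(1), of 0 "Suc i"] u by auto
          qed
        qed
        moreover have "separated E (S \<union> set xs)"
          using separated_Un_cycle[OF less.prems(3) v(1) xs(1) disj] .
        moreover have "w \<in> set xs" using xs(2) w(2) by auto
        then have "V - (S \<union> set xs) \<subset> V - S" using v(2) by blast
        then have "card (V - (S \<union> set xs)) < card (V - S)" using fS by (intro psubset_card_mono)
        moreover have "S \<union> set xs \<subseteq> V" "r \<in> S \<union> set xs" using less.prems xsV by auto
        ultimately show ?thesis using less.hyps by blast
      qed
    qed (use less.prems in auto)
  qed
  moreover have "separated E {r}" by (auto simp: separated_def)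
  ultimately show ?thesis using r by blast
qed

end

section \<open>Extending list colorings\<close>

text \<open>Common neighbors are sought only in \<open>S\<close>, so between vertices of
  \<open>S\<close> this is adjacency in the square of the subgraph induced by \<open>S\<close>,
  which is what a partial coloring has to respect during the growth.\<close>

definition square_adj :: "'a rel \<Rightarrow> 'a set \<Rightarrow> 'a \<Rightarrow> 'a \<Rightarrow> bool" where
  "square_adj E S u v \<longleftrightarrow> u \<noteq> v \<and> ((u, v) \<in> E \<or> (\<exists>z\<in>S. (u, z) \<in> E \<and> (z, v) \<in> E))"

definition square_coloring :: "'a rel \<Rightarrow> 'a set \<Rightarrow> ('a \<Rightarrow> 'c set) \<Rightarrow> ('a \<Rightarrow> 'c) \<Rightarrow> bool" where
  "square_coloring E S L c \<longleftrightarrow>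
    (\<forall>v\<in>S. c v \<in> L v) \<and> (\<forall>u\<in>S. \<forall>v\<in>S. square_adj E S u v \<longrightarrow> c u \<noteq> c v)"

lemma square_adj_sym: "sym E \<Longrightarrow> square_adj E S u v \<Longrightarrow> square_adj E S v u"
  unfolding square_adj_def by (blast dest: symD)

lemma card_Diff_ge: "finite B \<Longrightarrow> card B + n \<le> card A \<Longrightarrow> n \<le> card (A - B)"
  using diff_card_le_card_Diff[of B A] by linarith

context cactus_relation
begin

lemma finite_neighbors: "finite {u. (v, u) \<in> E}"
  by (rule finite_subset[OF _ finite_V]) (use E_subset in auto)

text \<open>The new vertex w sees v and the other neighbors of v, hence at most as many colors as
  the degree of v. Old pairs gain no adjacency because w has a single neighbor in
  \<open>S\<close>.\<close>

lemma square_coloring_insert: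
  assumes S: "S \<subseteq> V" "v \<in> S" "w \<in> V - S" "(v, w) \<in> E"
    and nbr: "\<And>u. u \<in> S \<Longrightarrow> (u, w) \<in> E \<Longrightarrow> u = v"
    and deg: "card {u. (v, u) \<in> E} < k" and L: "k \<le> card (L w)"
    and c: "square_coloring E S L c"
  shows "\<exists>c. square_coloring E (insert w S) L c"
proof -
  \<comment> \<open>This set may contain neighbors of v outside \<open>S\<close>, where the values
    of \<open>c\<close> are arbitrary; avoiding these values too is harmless because the degree of v
    already accounts for them.\<close>
  let ?N = "{u. (v, u) \<in> E} - {w}"
  have "Suc (card ?N) = card {u. (v, u) \<in> E}"
    using S(4) finite_neighbors by (intro card_Suc_Diff1) auto
  then have "card (insert (c v) (c ` ?N)) \<le> card {u. (v, u) \<in> E}"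
    using card_image_le[of ?N c] card_insert_if[of "c ` ?N" "c v"] finite_neighbors by simp
  then have "1 \<le> card (L w - insert (c v) (c ` ?N))"
    using deg L finite_neighbors by (intro card_Diff_ge) auto
  then have "L w - insert (c v) (c ` ?N) \<noteq> {}" by (metis card.empty not_one_le_zero)
  then obtain x where x: "x \<in> L w" "x \<noteq> c v" "x \<notin> c ` ?N" by blast
  have w: "x \<noteq> c u" if "u \<in> S" "square_adj E (insert w S) w u" for u
  proof -
    have "u = v \<or> u \<in> ?N"
      using that nbr S(3) E_sym irrefl_E unfolding square_adj_def by blast
    then show ?thesis using x by auto
  qed
  have S': "square_adj E S u u'" if "u \<in> S" "u' \<in> S" "square_adj E (insert w S) u u'" for u u'
    using that nbr E_sym unfolding square_adj_def by blast
  have "square_coloring E (insert w S) L (c(w := x))"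
    unfolding square_coloring_def
  proof (intro conjI ballI impI)
    fix u u' assume u: "u \<in> insert w S" "u' \<in> insert w S" "square_adj E (insert w S) u u'"
    then have ne: "u \<noteq> u'" by (simp add: square_adj_def)
    consider "u = w" "u' \<in> S" | "u' = w" "u \<in> S" | "u \<in> S" "u' \<in> S" using u ne by blast
    then show "(c(w := x)) u \<noteq> (c(w := x)) u'"
    proof cases
      case 1
      then show ?thesis using w[of u'] u(3) S(3) by auto
    next
      case 2
      then have "x \<noteq> c u" using w[of u] square_adj_sym[OF sym_E u(3)] by simp
      then show ?thesis using 2 S(3) by auto
    next
      case 3
      then have "c u \<noteq> c u'" using S'[OF 3 u(3)] c unfolding square_coloring_def by blast
      then show ?thesis using 3 S(3) by auto
    qed
  next
    fix u assume "u \<in> insert w S"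
    then show "(c(w := x)) u \<in> L u" using x c by (auto simp: square_coloring_def)
  qed
  then show ?thesis by blast
qed

lemma square_coloring_Un_cycle:
  assumes S: "S \<subseteq> V" "v \<in> S" "set xs \<subseteq> V - S" and cyc: "cycle_list E (v # xs)"
    and nbr: "\<And>u i. u \<in> S \<Longrightarrow> i < length xs \<Longrightarrow> (u, xs ! i) \<in> E \<Longrightarrow>
        u = v \<and> (i = 0 \<or> Suc i = length xs)"
    and chord: "\<And>i j. i < j \<Longrightarrow> j < length xs \<Longrightarrow> (xs ! i, xs ! j) \<in> E \<Longrightarrow> j = Suc i"
    and deg: "card {u. (v, u) \<in> E} < k" and L: "\<And>u. u \<in> set xs \<Longrightarrow> k \<le> card (L u)"
    and k: "4 \<le> k" "5 \<le> k \<or> length xs \<noteq> 4"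
    and c: "square_coloring E S L c"
  shows "\<exists>c. square_coloring E (S \<union> set xs) L c"
proof -
  define m where "m = length xs"
  have m: "2 \<le> m" and dist: "distinct xs"
    using cyc by (auto simp: cycle_list_def m_def)
  have ends: "(v, xs ! 0) \<in> E" "(v, xs ! (m - 1)) \<in> E"
  proof -
    have "xs \<noteq> []" using m by (auto simp: m_def)
    then show "(v, xs ! 0) \<in> E" "(v, xs ! (m - 1)) \<in> E"
      using cyc E_sym[of "last xs" v]
      by (auto simp: cycle_list_def walk_list_Cons hd_conv_nth last_conv_nth m_def split: if_splits)
  qed
  define N where "N = {u \<in> S. (v, u) \<in> E}"
  have finN: "finite N" unfolding N_def by (rule finite_subset[OF _ finite_neighbors]) auto
  have "card N + 2 \<le> card {u. (v, u) \<in> E}"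
  proof -
    have "0 < length xs" "m - 1 < length xs" "0 \<noteq> m - 1" using m m_def by linarith+
    then have "xs ! 0 \<in> set xs" "xs ! (m - 1) \<in> set xs" "xs ! 0 \<noteq> xs ! (m - 1)"
      using nth_eq_iff_index_eq[OF dist, of 0 "m - 1"] by simp_all
    then have "card (N \<union> {xs ! 0, xs ! (m - 1)}) = card N + 2"
      using S(3) finN by (subst card_Un_disjoint) (auto simp: N_def)
    moreover have "N \<union> {xs ! 0, xs ! (m - 1)} \<subseteq> {u. (v, u) \<in> E}"
      using ends by (auto simp: N_def)
    ultimately show ?thesis using card_mono[OF finite_neighbors] by metis
  qed
  then have cardN: "card (insert (c v) (c ` N)) + 2 \<le> k"
    using deg card_image_le[OF finN, of c] card_insert_if[of "c ` N" "c v"] finN by auto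
  \<comment> \<open>An end of \<open>xs\<close> sees v and the neighbors of v in \<open>S\<close>; a
    vertex next to an end sees only v. For m = 3 the middle vertex is next to both ends but still
    loses a single color.\<close>
  define A where "A i = L (xs ! i) - (if i = 0 \<or> Suc i = m then insert (c v) (c ` N)
    else if i = 1 \<or> i + 2 = m then {c v} else {})" for i
  have Li: "k \<le> card (L (xs ! i))" if "i < m" for i using L[of "xs ! i"] that by (simp add: m_def)
  have "\<exists>d. (\<forall>i<m. d i \<in> A i) \<and> (\<forall>i. i + 1 < m \<longrightarrow> d i \<noteq> d (i + 1)) \<and>
    (\<forall>i. i + 2 < m \<longrightarrow> d i \<noteq> d (i + 2)) \<and> d 0 \<noteq> d (m - 1)"
  proof (rule list_coloring_pendant_cycle[OF m])
    show "2 \<le> card (A 0)" using Li[of 0] m cardN finN by (auto simp: A_def intro!: card_Diff_ge)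
    show "2 \<le> card (A (m - 1))"
      using Li[of "m - 1"] m cardN finN by (auto simp: A_def intro!: card_Diff_ge)
    show "3 \<le> card (A i)" if "0 < i" "i < m - 1" for i
    proof -
      have "k \<le> card (L (xs ! i))" using that by (intro Li) linarith
      then show ?thesis using that k(1) by (auto simp: A_def intro!: card_Diff_ge)
    qed
    show "4 \<le> card (A i)" if "1 < i" "i < m - 2" for i
    proof -
      have "k \<le> card (L (xs ! i))" using that by (intro Li) linarith
      then show ?thesis using that k(1) by (auto simp: A_def)
    qed
    show "4 \<le> card (A 1) \<and> 4 \<le> card (A 2)" if "m = 4"
      using Li[of 1] Li[of 2] that k by (auto simp: A_def m_def intro!: card_Diff_ge)
  qed
  then obtain d where d: "\<And>i. i < m \<Longrightarrow> d i \<in> A i" "\<And>i. i + 1 < m \<Longrightarrow> d i \<noteq> d (i + 1)"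
    "\<And>i. i + 2 < m \<Longrightarrow> d i \<noteq> d (i + 2)" "d 0 \<noteq> d (m - 1)" by blast
  let ?S = "S \<union> set xs"
  have adj: "j = Suc i \<or> i = Suc j" if "i < m" "j < m" "(xs ! i, xs ! j) \<in> E" for i j
    using chord[of i j] chord[of j i] that E_sym irrefl_E
    by (cases i j rule: linorder_cases) (auto simp: m_def)
  have nbr': "u = v \<and> (i = 0 \<or> Suc i = m)" if "u \<in> S" "i < m" "(u, xs ! i) \<in> E" for u i
    using nbr that by (simp add: m_def)
  have in_xs: "\<exists>l<m. z = xs ! l" if "z \<in> set xs" for z
    using that by (metis in_set_conv_nth m_def)
  have S_xs: "d i \<noteq> c u" if u: "u \<in> S" "i < m" "square_adj E ?S u (xs ! i)" for u i
  proof -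
    have "(u = v \<and> (i = 0 \<or> Suc i = m)) \<or> (u \<in> N \<and> (i = 0 \<or> Suc i = m)) \<or>
      (u = v \<and> (i = 1 \<or> i + 2 = m))"
    proof (cases "(u, xs ! i) \<in> E")
      case True
      then show ?thesis using nbr'[OF u(1,2)] by blast
    next
      case False
      then obtain z where z: "z \<in> ?S" "(u, z) \<in> E" "(z, xs ! i) \<in> E"
        using u(3) by (auto simp: square_adj_def)
      show ?thesis
      proof (cases "z \<in> S")
        case True
        then have "z = v" "i = 0 \<or> Suc i = m" using nbr'[OF _ u(2) z(3)] by blast+
        then show ?thesis using z(2) E_sym u(1) by (auto simp: N_def)
      next
        case False
        then obtain l where l: "l < m" "z = xs ! l" using in_xs z(1) by blast
        then have "u = v" "l = 0 \<or> Suc l = m" "i = Suc l \<or> l = Suc i"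
          using nbr'[OF u(1)] adj[OF _ u(2)] z by blast+
        then show ?thesis using u(2) by auto
      qed
    qed
    then show ?thesis using d(1)[OF u(2)] by (auto simp: A_def split: if_splits)
  qed
  have xs_xs: "d i \<noteq> d j" if i: "i < j" "j < m" "square_adj E ?S (xs ! i) (xs ! j)" for i j
  proof -
    \<comment> \<open>The last alternative comes from v as the common neighbor of the two
      ends.\<close>
    have "j = i + 1 \<or> j = i + 2 \<or> (i = 0 \<and> j = m - 1)"
    proof (cases "(xs ! i, xs ! j) \<in> E")
      case True
      then show ?thesis using adj[of i j] i by auto
    next
      case False
      then obtain z where z: "z \<in> ?S" "(xs ! i, z) \<in> E" "(z, xs ! j) \<in> E"
        using i(3) by (auto simp: square_adj_def)
      show ?thesis
      proof (cases "z \<in> S")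
        case True
        then have "i = 0 \<or> Suc i = m" "j = 0 \<or> Suc j = m"
          using nbr'[of z i] nbr'[of z j] i z E_sym by auto
        then show ?thesis using i by auto
      next
        case False
        then obtain l where l: "l < m" "z = xs ! l" using in_xs z(1) by blast
        then have "l = Suc i \<or> i = Suc l" "j = Suc l \<or> l = Suc j"
          using adj[of i l] adj[of l j] i z by auto
        then show ?thesis using i by auto
      qed
    qed
    then show ?thesis using d(2-4) i by auto
  qed
  define f where "f u = (if u \<in> S then c u else d (inv_into {..<m} ((!) xs) u))" for u
  have fS: "f u = c u" if "u \<in> S" for u using that by (simp add: f_def)
  have fx: "f (xs ! i) = d i" if "i < m" for i
  proof -
    have "xs ! i \<notin> S" using that S(3) nth_mem[of i xs] unfolding m_def by blast
    moreover have "inv_into {..<m} ((!) xs) (xs ! i) = i"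
      using that dist by (intro inv_into_f_f inj_on_nth) (auto simp: m_def)
    ultimately show ?thesis by (simp add: f_def)
  qed
  have "square_coloring E ?S L f"
    unfolding square_coloring_def
  proof (intro conjI ballI impI)
    fix u assume u: "u \<in> ?S"
    show "f u \<in> L u"
    proof (cases "u \<in> S")
      case True
      then show ?thesis using c fS by (auto simp: square_coloring_def)
    next
      case False
      then obtain i where "i < m" "u = xs ! i" using u in_xs by blast
      then show ?thesis using fx d(1)[of i] by (auto simp: A_def)
    qed
  next
    fix u u' assume u: "u \<in> ?S" "u' \<in> ?S" "square_adj E ?S u u'"
    have u': "square_adj E ?S u' u" using square_adj_sym[OF sym_E u(3)] .
    show "f u \<noteq> f u'"
    proof (cases "u \<in> S"; cases "u' \<in> S")
      assume a: "u \<in> S" "u' \<in> S"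
      have "square_adj E S u u'"
      proof -
        have "u = u'" if "z \<in> set xs" "(u, z) \<in> E" "(z, u') \<in> E" for z
          using in_xs[OF that(1)] nbr' that(2) E_sym[OF that(3)] a by blast
        then show ?thesis using u(3) unfolding square_adj_def by blast
      qed
      then show ?thesis using a c fS by (auto simp: square_coloring_def)
    next
      assume a: "u \<in> S" "u' \<notin> S"
      then obtain i where "i < m" "u' = xs ! i" using u in_xs by blast
      then show ?thesis using S_xs[of u i] a u fx fS by auto
    next
      assume a: "u \<notin> S" "u' \<in> S"
      then obtain i where "i < m" "u = xs ! i" using u in_xs by blast
      then show ?thesis using S_xs[of u' i] a u' fx fS by auto
    next
      assume a: "u \<notin> S" "u' \<notin> S"
      obtain i where i: "i < m" "u = xs ! i" using a(1) u in_xs by blast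
      obtain j where j: "j < m" "u' = xs ! j" using a(2) u in_xs by blast
      have "i \<noteq> j" using i j u(3) by (auto simp: square_adj_def)
      then consider "i < j" | "j < i" by linarith
      then show ?thesis
        using xs_xs[of i j] xs_xs[of j i] i j u(3) u' fx by cases auto
    qed
  qed
  then show ?thesis by blast
qed

text \<open>The condition on k is tied to the existence of cycles. Without cycles the degree bound
  alone decides, which covers paths with fewer than four colors.\<close>

theorem cactus_square_choosable:
  assumes deg: "\<And>v. v \<in> V \<Longrightarrow> card {u. (v, u) \<in> E} < k"
    and L: "\<And>v. v \<in> V \<Longrightarrow> k \<le> card (L v)"
    and cyc: "\<And>zs. cycle_list E zs \<Longrightarrow> 4 \<le> k \<and> (5 \<le> k \<or> length zs \<noteq> 5)"
  shows "\<exists>c. square_coloring E V L c"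
proof (cases "V = {}")
  case False
  then obtain r where r: "r \<in> V" by blast
  show ?thesis
  proof (rule cactus_induct[OF r])
    have "L r \<noteq> {}" using L[OF r] deg[OF r] by auto
    then obtain x where "x \<in> L r" by blast
    then show "\<exists>c. square_coloring E {r} L c"
      by (intro exI[of _ "\<lambda>_. x"]) (auto simp: square_coloring_def square_adj_def)
  next
    fix S v w
    assume a: "S \<subseteq> V" "v \<in> S" "w \<in> V - S" "(v, w) \<in> E"
      "\<And>u. u \<in> S \<Longrightarrow> (u, w) \<in> E \<Longrightarrow> u = v" "\<exists>c. square_coloring E S L c"
    have "v \<in> V" "w \<in> V" using a(1-3) by blast+
    note k = deg[OF this(1)] L[OF this(2)]
    obtain c where c: "square_coloring E S L c" using a(6) by blast
    show "\<exists>c. square_coloring E (insert w S) L c"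
      by (rule square_coloring_insert[OF a(1-4) _ k c]) (fact a(5))
  next
    fix S v xs
    assume a: "S \<subseteq> V" "v \<in> S" "set xs \<subseteq> V - S" "cycle_list E (v # xs)"
      "\<And>u i. u \<in> S \<Longrightarrow> i < length xs \<Longrightarrow> (u, xs ! i) \<in> E \<Longrightarrow>
        u = v \<and> (i = 0 \<or> Suc i = length xs)"
      "\<And>i j. i < j \<Longrightarrow> j < length xs \<Longrightarrow> (xs ! i, xs ! j) \<in> E \<Longrightarrow> j = Suc i"
      "\<exists>c. square_coloring E S L c"
    have v: "v \<in> V" using a(1,2) by blast
    obtain c where c: "square_coloring E S L c" using a(7) by blast
    show "\<exists>c. square_coloring E (S \<union> set xs) L c"
    proof (rule square_coloring_Un_cycle[OF a(1-4) _ _ deg[OF v] _ _ _ c])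
      show "4 \<le> k" "5 \<le> k \<or> length xs \<noteq> 4" using cyc[OF a(4)] by auto
      show "k \<le> card (L u)" if "u \<in> set xs" for u using L a(3) that by blast
    qed (fact a(5), fact a(6))
  qed
qed (simp add: square_coloring_def)

end

section \<open>Squares of cycles of length divisible by three\<close>

text \<open>This is the leading coefficient of the Lagrange basis polynomial of the node x. Summing
  the values of a function with these weights yields the coefficient in degree
  \<open>card L - 1\<close> of its interpolation polynomial on \<open>L\<close>.\<close>

definition lagrange_weight :: "real set \<Rightarrow> real \<Rightarrow> real" where
  "lagrange_weight L x = inverse (\<Prod>d\<in>L - {x}. x - d)"

text \<open>With three nodes the weighted sum is the second divided difference, which kills
  constants and linear terms and sends the square to 1.\<close>

lemma sum_power_lagrange_weight:
  assumes "card L = 3" "e \<le> 2"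
  shows "(\<Sum>x\<in>L. x ^ e * lagrange_weight L x) = (if e = 2 then 1 else 0)"
proof -
  obtain a b c where L: "L = {a, b, c}" "a \<noteq> b" "b \<noteq> c" "a \<noteq> c"
    using assms(1) card_3_iff[of L] by auto
  have "L - {a} = {b, c}" "L - {b} = {a, c}" "L - {c} = {a, b}" using L by auto
  then have w: "lagrange_weight L a = inverse ((a - b) * (a - c))"
    "lagrange_weight L b = inverse ((b - a) * (b - c))"
    "lagrange_weight L c = inverse ((c - a) * (c - b))"
    using L by (simp_all add: lagrange_weight_def)
  \<comment> \<open>Up to sign all denominators are products of the gaps p, q and p + q. Over the
    common denominator p q (p + q) a polynomial identity is left for each exponent.\<close>
  define p q where "p = a - b" and "q = b - c"
  have pq: "a = c + p + q" "b = c + q" "p \<noteq> 0" "q \<noteq> 0" "p + q \<noteq> 0"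
    using L by (auto simp: p_def q_def)
  have "(\<Sum>x\<in>L. x ^ e * lagrange_weight L x) =
    a ^ e / ((a - b) * (a - c)) + b ^ e / ((b - a) * (b - c)) + c ^ e / ((c - a) * (c - b))"
    using L(2-4) w unfolding L(1) by (simp add: divide_inverse)
  also have "\<dots> = a ^ e / (p * (p + q)) - b ^ e / (p * q) + c ^ e / ((p + q) * q)"
  proof -
    have "(a - b) * (a - c) = p * (p + q)" "(b - a) * (b - c) = - (p * q)"
      "(c - a) * (c - b) = (p + q) * q"
      by (simp_all add: p_def q_def algebra_simps)
    then show ?thesis by (simp only: divide_minus_right add_uminus_conv_diff)
  qed
  also have "\<dots> = (a ^ e * q - b ^ e * (p + q) + c ^ e * p) / (p * q * (p + q))"
    using pq(3-5) by (simp add: divide_simps)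
  also have "a ^ e * q - b ^ e * (p + q) + c ^ e * p = (if e = 2 then p * q * (p + q) else 0)"
  proof -
    consider "e = 0" | "e = 1" | "e = 2" using assms(2) by linarith
    then show ?thesis
      by cases (simp_all add: pq(1,2) algebra_simps power2_eq_square)
  qed
  finally show ?thesis using pq(3-5) by auto
qed

text \<open>In the expansion of the product, \<open>X\<close> collects the factors whose second term
  is taken; it amounts to an orientation of the multigraph with edges \<open>J\<close>. The
  resulting monomial has total degree \<open>2 * card I\<close>, so either some exponent is below 2
  and its weighted sum vanishes, or all exponents are 2 and the sum is 1. What remains is a signed
  count of orientations, in which \<open>L\<close> no longer appears.\<close>

lemma weighted_graph_polynomial_sum:
  fixes L :: "'i \<Rightarrow> real set" and u v :: "'j \<Rightarrow> 'i"
  assumes I: "finite I" and J: "finite J" "card J = 2 * card I"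
    and uv: "u ` J \<subseteq> I" "v ` J \<subseteq> I" and L: "\<And>i. i \<in> I \<Longrightarrow> card (L i) = 3"
  shows "(\<Sum>c\<in>PiE I L. (\<Prod>j\<in>J. c (u j) - c (v j)) * (\<Prod>i\<in>I. lagrange_weight (L i) (c i))) =
    (\<Sum>X\<in>Pow J. (-1) ^ card X *
      (if \<forall>i\<in>I. card {j\<in>J. (if j \<in> X then v j else u j) = i} = 2 then 1 else 0))"
proof -
  define e where "e X i = card {j\<in>J. (if j \<in> X then v j else u j) = i}" for X i
  have mono: "(\<Prod>j\<in>X. c (v j)) * (\<Prod>j\<in>J - X. c (u j)) = (\<Prod>i\<in>I. c i ^ e X i)"
    if X: "X \<subseteq> J" for X and c :: "'i \<Rightarrow> real"
  proof -
    define h where "h j = (if j \<in> X then v j else u j)" for j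
    have "(\<Prod>j\<in>X. c (v j)) * (\<Prod>j\<in>J - X. c (u j)) = (\<Prod>j\<in>X. c (h j)) * (\<Prod>j\<in>J - X. c (h j))"
      by (simp add: h_def)
    also have "\<dots> = (\<Prod>j\<in>J. c (h j))"
      using prod.subset_diff[OF X J(1), of "\<lambda>j. c (h j)"] by (simp add: mult.commute)
    also have "\<dots> = (\<Prod>i\<in>I. \<Prod>j\<in>{j\<in>J. h j = i}. c (h j))"
      by (rule prod.group[symmetric, OF J(1) I]) (use uv in \<open>auto simp: h_def\<close>)
    also have "\<dots> = (\<Prod>i\<in>I. c i ^ e X i)"
      by (intro prod.cong) (auto simp: e_def h_def)
    finally show ?thesis .
  qed
  have esum: "(\<Sum>i\<in>I. e X i) = 2 * card I" for X
  proof -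
    have "(\<Sum>i\<in>I. \<Sum>j\<in>{j\<in>J. (if j \<in> X then v j else u j) = i}. 1) = (\<Sum>j\<in>J. (1::nat))"
      by (rule sum.group[OF J(1) I]) (use uv in auto)
    then show ?thesis using J by (simp add: e_def)
  qed
  have one: "(\<Prod>i\<in>I. \<Sum>x\<in>L i. x ^ e X i * lagrange_weight (L i) x) =
    (if \<forall>i\<in>I. e X i = 2 then 1 else 0)" for X
  proof (cases "\<exists>i\<in>I. e X i < 2")
    case True
    then obtain i where i: "i \<in> I" "e X i < 2" by blast
    then have "(\<Sum>x\<in>L i. x ^ e X i * lagrange_weight (L i) x) = 0"
      using sum_power_lagrange_weight[OF L[OF i(1)], of "e X i"] by simp
    then show ?thesis using i I by (auto intro!: prod_zero)
  next
    \<comment> \<open>Exponents that are all at least 2 and add up to \<open>2 * card I\<close> are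
      all equal to 2.\<close>
    case False
    have all2: "e X i = 2" if "i \<in> I" for i
    proof (rule ccontr)
      assume "e X i \<noteq> 2"
      then have "(\<Sum>i\<in>I. 2) < (\<Sum>i\<in>I. e X i)"
        using False that I by (intro sum_strict_mono_ex1) force+
      then show False using esum[of X] by simp
    qed
    then show ?thesis using L by (simp add: sum_power_lagrange_weight)
  qed
  have fin: "finite (L i)" if "i \<in> I" for i using L[OF that] by (intro card_ge_0_finite) simp
  have "(\<Sum>c\<in>PiE I L. (\<Prod>j\<in>J. c (u j) - c (v j)) * (\<Prod>i\<in>I. lagrange_weight (L i) (c i))) =
    (\<Sum>c\<in>PiE I L. \<Sum>X\<in>Pow J. (-1) ^ card X *
      (\<Prod>i\<in>I. c i ^ e X i * lagrange_weight (L i) (c i)))"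
  proof (rule sum.cong[OF refl])
    fix c :: "'i \<Rightarrow> real"
    have "(\<Prod>j\<in>J. c (u j) - c (v j)) = (\<Sum>X\<in>Pow J. (-1) ^ card X * (\<Prod>i\<in>I. c i ^ e X i))"
      unfolding prod_diff_conv_sum[OF J(1)]
      by (intro sum.cong refl) (simp add: mono mult.assoc)
    then show "(\<Prod>j\<in>J. c (u j) - c (v j)) * (\<Prod>i\<in>I. lagrange_weight (L i) (c i)) =
      (\<Sum>X\<in>Pow J. (-1) ^ card X * (\<Prod>i\<in>I. c i ^ e X i * lagrange_weight (L i) (c i)))"
      by (simp add: sum_distrib_right prod.distrib mult.assoc)
  qed
  also have "\<dots> = (\<Sum>X\<in>Pow J. \<Sum>c\<in>PiE I L. (-1) ^ card X *
      (\<Prod>i\<in>I. c i ^ e X i * lagrange_weight (L i) (c i)))"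
    by (rule sum.swap)
  also have "\<dots> = (\<Sum>X\<in>Pow J. (-1) ^ card X *
      (\<Prod>i\<in>I. \<Sum>x\<in>L i. x ^ e X i * lagrange_weight (L i) x))"
    using I fin by (simp add: prod_sum_PiE sum_distrib_left)
  finally show ?thesis unfolding one unfolding e_def .
qed

text \<open>
  By the previous lemma the weighted sum of the graph polynomial over all list colorings does not
  depend on the lists. For the constant lists \<open>{0, 1, 2}\<close> every proper coloring contributes \<open>1\<close>,
  because the two successors of a vertex carry exactly the two colors other than its own.
\<close>

lemma cycle_square_3_choosable:
  fixes L :: "nat \<Rightarrow> nat set"
  assumes n: "3 \<le> n" "3 dvd n" and L: "\<And>i. i < n \<Longrightarrow> 3 \<le> card (L i)"
  shows "\<exists>c. \<forall>i<n. c i \<in> L i \<and> c i \<noteq> c (Suc i mod n) \<and> c i \<noteq> c ((i + 2) mod n)"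
proof -
  define I where "I = {..<n}"
  \<comment> \<open>One factor belongs to each vertex and each step 1 or 2 along the cycle. For n =
    3 every pair of vertices occurs twice, so that \<open>J\<close> is twice as large as
    \<open>I\<close> in this case too.\<close>
  define J where "J = I \<times> {1::nat, 2}"
  define v where "v j = (fst j + snd j) mod n" for j :: "nat \<times> nat"
  have cJ: "finite I" "finite J" "card J = 2 * card I"
    by (auto simp: J_def I_def card_cartesian_product)
  have uv: "fst ` J \<subseteq> I" "v ` J \<subseteq> I" using n by (auto simp: J_def I_def v_def)
  define W where "W M c = (\<Prod>j\<in>J. c (fst j) - c (v j)) *
    (\<Prod>i\<in>I. lagrange_weight (M i) (c i))" for M :: "nat \<Rightarrow> real set" and c
  define T where "T = {0, 1, 2 :: real}"
  have PJ: "(\<Prod>j\<in>J. c (fst j) - c (v j)) =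
    (\<Prod>i\<in>I. (c i - c (Suc i mod n)) * (c i - c ((i + 2) mod n)))" for c :: "nat \<Rightarrow> real"
  proof -
    have "(\<Prod>j\<in>J. c (fst j) - c (v j)) = (\<Prod>i\<in>I. \<Prod>d\<in>{1, 2}. c i - c ((i + d) mod n))"
      by (simp only: J_def v_def prod.cartesian_product' fst_conv snd_conv)
    then show ?thesis by simp
  qed
  have W_T: "W (\<lambda>_. T) c = (if \<forall>i\<in>I. c i \<noteq> c (Suc i mod n) \<and> c i \<noteq> c ((i + 2) mod n)
      then 1 else 0)" if c: "c \<in> PiE I (\<lambda>_. T)" for c
  proof (cases "\<forall>i\<in>I. c i \<noteq> c (Suc i mod n) \<and> c i \<noteq> c ((i + 2) mod n)")
    case True
    have "lagrange_weight T (c i) =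
      inverse ((c i - c (Suc i mod n)) * (c i - c ((i + 2) mod n)))" if i: "i \<in> I" for i
    proof -
      let ?a = "c i" and ?b = "c (Suc i mod n)" and ?d = "c ((i + 2) mod n)"
      have s: "Suc i mod n \<in> I" "(i + 2) mod n \<in> I" using n by (auto simp: I_def)
      then have abd: "?a \<in> T" "?b \<in> T" "?d \<in> T" using c i by auto
      have "Suc (Suc i mod n) mod n = (i + 2) mod n" by (simp add: mod_simps)
      then have "?b \<noteq> ?d" using True s(1) by force
      moreover have "?a \<noteq> ?b" "?a \<noteq> ?d" using True i by auto
      ultimately have "T - {?a} = {?b, ?d}" "?b \<noteq> ?d" using abd by (auto simp: T_def)
      then show ?thesis by (simp add: lagrange_weight_def)
    qed
    then have "W (\<lambda>_. T) c = (\<Prod>i\<in>I. (c i - c (Suc i mod n)) * (c i - c ((i + 2) mod n)) *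
      inverse ((c i - c (Suc i mod n)) * (c i - c ((i + 2) mod n))))"
      unfolding W_def PJ prod.distrib[symmetric] by (intro prod.cong) auto
    also have "\<dots> = (\<Prod>i\<in>I. 1)" using True by (intro prod.cong refl right_inverse) auto
    finally show ?thesis using True by simp
  next
    case False
    then have "(\<Prod>j\<in>J. c (fst j) - c (v j)) = 0"
      unfolding PJ using cJ(1) by (auto intro!: prod_zero)
    then show ?thesis using False by (simp add: W_def)
  qed
  \<comment> \<open>The pattern 0, 1, 2 closes up because 3 divides n. It contributes 1 and no
    coloring contributes a negative amount, so the sum is positive.\<close>
  define c0 :: "nat \<Rightarrow> real" where "c0 = restrict (\<lambda>i. real (i mod 3)) I"
  have c0: "c0 \<in> PiE I (\<lambda>_. T)"
  proof -
    have "real (i mod 3) \<in> T" for i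
    proof -
      have "i mod 3 = 0 \<or> i mod 3 = 1 \<or> i mod 3 = 2" by linarith
      then show ?thesis by (auto simp: T_def)
    qed
    then show ?thesis by (auto simp: c0_def)
  qed
  have "c0 i \<noteq> c0 (Suc i mod n) \<and> c0 i \<noteq> c0 ((i + 2) mod n)" if "i \<in> I" for i
  proof -
    have "Suc i mod n mod 3 = Suc i mod 3" "(i + 2) mod n mod 3 = (i + 2) mod 3"
      using n(2) by (simp_all add: mod_mod_cancel)
    moreover have "Suc i mod 3 \<noteq> i mod 3" "(i + 2) mod 3 \<noteq> i mod 3" by presburger+
    ultimately show ?thesis using that n by (simp add: c0_def I_def)
  qed
  then have t0: "W (\<lambda>_. T) c0 = 1" using W_T[OF c0] by simp
  have finT: "finite (PiE I (\<lambda>_. T))" using cJ by (auto intro!: finite_PiE simp: T_def)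
  have "W (\<lambda>_. T) c0 \<le> (\<Sum>c\<in>PiE I (\<lambda>_. T). W (\<lambda>_. T) c)"
    by (rule member_le_sum) (use c0 finT W_T in auto)
  then have pos: "(\<Sum>c\<in>PiE I (\<lambda>_. T). W (\<lambda>_. T) c) \<noteq> 0" using t0 by linarith
  \<comment> \<open>The lists are cut down to three colors, the size for which the weights single
    out the exponent 2, and then embedded into the reals.\<close>
  have "\<forall>i. \<exists>K. i < n \<longrightarrow> K \<subseteq> L i \<and> card K = 3"
    using L obtain_subset_with_card_n by metis
  then obtain K where K: "\<And>i. i < n \<Longrightarrow> K i \<subseteq> L i" "\<And>i. i < n \<Longrightarrow> card (K i) = 3" by metis
  define M where "M i = real ` K i" for i
  have M: "card (M i) = 3" if "i \<in> I" for i
    using K(2)[of i] that by (simp add: M_def I_def card_image)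
  have T: "card T = 3" by (simp add: T_def)
  have "(\<Sum>c\<in>PiE I M. W M c) = (\<Sum>c\<in>PiE I (\<lambda>_. T). W (\<lambda>_. T) c)"
    using weighted_graph_polynomial_sum[OF cJ uv M] weighted_graph_polynomial_sum[OF cJ uv T]
    unfolding W_def by simp
  then have "\<exists>c\<in>PiE I M. W M c \<noteq> 0" using pos sum.neutral[of "PiE I M" "W M"] by metis
  then obtain c where c: "c \<in> PiE I M" "W M c \<noteq> 0" by blast
  then have "(\<Prod>j\<in>J. c (fst j) - c (v j)) \<noteq> 0" by (auto simp: W_def)
  then have ne: "\<forall>i\<in>I. c i \<noteq> c (Suc i mod n) \<and> c i \<noteq> c ((i + 2) mod n)"
    unfolding PJ using cJ(1) by auto
  have "\<forall>i. \<exists>x. i < n \<longrightarrow> x \<in> K i \<and> c i = real x"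
    using c(1) by (auto simp: M_def I_def PiE_iff)
  then obtain d where d: "\<And>i. i < n \<Longrightarrow> d i \<in> K i \<and> c i = real (d i)" by metis
  show ?thesis
  proof (intro exI[of _ d] allI impI)
    fix i assume i: "i < n"
    have s: "Suc i mod n < n" "(i + 2) mod n < n" using n by auto
    show "d i \<in> L i \<and> d i \<noteq> d (Suc i mod n) \<and> d i \<noteq> d ((i + 2) mod n)"
      using d[OF i] d[OF s(1)] d[OF s(2)] bspec[OF ne, of i] i K(1)[OF i] unfolding I_def by auto
  qed
qed

section \<open>Graphs as relations\<close>

text \<open>Arcs are pairs of vertices with the projections as tail and head on both sides, so the
  arc part of an isomorphism with vertex part f can only be \<open>map_prod f f\<close>.\<close>

lemma pair_digraph_iso_iff:
  assumes "pair_wf_digraph G"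
  shows "digraph_iso (with_proj G) (with_proj H) \<longleftrightarrow>
    (\<exists>f. inj_on f (pverts G) \<and> pverts H = f ` pverts G \<and> parcs H = map_prod f f ` parcs G)"
proof
  assume "digraph_iso (with_proj G) (with_proj H)"
  then obtain h where h: "pre_digraph.digraph_isomorphism (with_proj G) h"
    "with_proj H = app_iso h (with_proj G)"
    by (auto simp: digraph_iso_def)
  have t: "iso_tail h = fst" "iso_head h = snd" "pverts H = iso_verts h ` pverts G"
    "parcs H = iso_arcs h ` parcs G"
    using h(2) by (metis app_iso_simps with_proj_simps)+
  have "iso_arcs h a = map_prod (iso_verts h) (iso_verts h) a" if "a \<in> parcs G" for a
    using h(1) that t(1,2) by (auto simp: pre_digraph.digraph_isomorphism_def prod_eq_iff)
  then have "parcs H = map_prod (iso_verts h) (iso_verts h) ` parcs G" using t(4) by auto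
  then show "\<exists>f. inj_on f (pverts G) \<and> pverts H = f ` pverts G \<and> parcs H = map_prod f f ` parcs G"
    using h(1) t(3) by (auto simp: pre_digraph.digraph_isomorphism_def)
next
  assume "\<exists>f. inj_on f (pverts G) \<and> pverts H = f ` pverts G \<and> parcs H = map_prod f f ` parcs G"
  then obtain f where f: "inj_on f (pverts G)" "pverts H = f ` pverts G"
    "parcs H = map_prod f f ` parcs G" by blast
  interpret G: pair_wf_digraph G by fact
  have "parcs G \<subseteq> pverts G \<times> pverts G" by (auto dest: G.in_arcsD1 G.in_arcsD2)
  then have inj: "inj_on (map_prod f f) (parcs G)"
    using map_prod_inj_on[OF f(1) f(1)] by (rule inj_on_subset[rotated])
  define h where "h = \<lparr>iso_verts = f, iso_arcs = map_prod f f, iso_head = snd, iso_tail = fst\<rparr>"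
  have "pre_digraph.digraph_isomorphism (with_proj G) h"
    unfolding pre_digraph.digraph_isomorphism_def
    using f inj by (simp add: h_def G.wf_digraph)
  moreover have "with_proj H = app_iso h (with_proj G)"
    using f by (simp add: h_def app_iso_def with_proj_def)
  ultimately show "digraph_iso (with_proj G) (with_proj H)" by (auto simp: digraph_iso_def)
qed

text \<open>The list acts as a labeling, in which number i stands for \<open>zs ! i\<close>. Being
  isomorphic to a path or cycle on numbers becomes an equation between graphs, from which walks and
  cycles can be read off as lists.\<close>

definition image_graph :: "'a list \<Rightarrow> nat pair_pre_digraph \<Rightarrow> 'a pair_pre_digraph" where
  "image_graph zs H = \<lparr> pverts = (!) zs ` pverts H, parcs = map_prod ((!) zs) ((!) zs) ` parcs H \<rparr>"

lemma digraph_iso_image_graph_iff: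
  assumes G: "pair_wf_digraph G" and H: "pair_wf_digraph H" "pverts H = {..<n}"
  shows "digraph_iso (with_proj G) (with_proj H) \<longleftrightarrow>
    (\<exists>zs. distinct zs \<and> length zs = n \<and> G = image_graph zs H)"
  unfolding pair_digraph_iso_iff[OF G]
proof
  interpret G: pair_wf_digraph G by fact
  assume "\<exists>f. inj_on f (pverts G) \<and> pverts H = f ` pverts G \<and> parcs H = map_prod f f ` parcs G"
  then obtain f where f: "inj_on f (pverts G)" "pverts H = f ` pverts G"
    "parcs H = map_prod f f ` parcs G" by blast
  let ?g = "the_inv_into (pverts G) f"
  let ?zs = "map ?g [0..<n]"
  have gf: "?g (f x) = x" if "x \<in> pverts G" for x using the_inv_into_f_f[OF f(1) that] .
  have zs: "?zs ! f x = x" if "x \<in> pverts G" for x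
  proof -
    have "f x \<in> {..<n}" using f(2) H(2) that by blast
    then show ?thesis using gf[OF that] by simp
  qed
  have "distinct ?zs"
    using inj_on_the_inv_into[OF f(1)] H(2) f(2) by (simp add: distinct_map atLeast0LessThan)
  moreover have "pverts G = (!) ?zs ` pverts H" unfolding f(2) image_image using zs by force
  moreover have "parcs G = map_prod ((!) ?zs) ((!) ?zs) ` parcs H"
  proof -
    have "map_prod ((!) ?zs) ((!) ?zs) (map_prod f f a) = a" if "a \<in> parcs G" for a
      using zs[OF G.arc_fst_in_verts[OF that]] zs[OF G.arc_snd_in_verts[OF that]]
      by (cases a) simp
    then show ?thesis unfolding f(3) image_image by force
  qed
  ultimately show "\<exists>zs. distinct zs \<and> length zs = n \<and> G = image_graph zs H"
    by (intro exI[of _ ?zs]) (simp add: image_graph_def)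
next
  interpret H: pair_wf_digraph H by fact
  assume "\<exists>zs. distinct zs \<and> length zs = n \<and> G = image_graph zs H"
  then obtain zs where zs: "distinct zs" "length zs = n"
    and G': "pverts G = (!) zs ` {..<n}" "parcs G = map_prod ((!) zs) ((!) zs) ` parcs H"
    using H(2) by (auto simp: image_graph_def)
  have inj: "inj_on ((!) zs) {..<n}" using zs by (intro inj_on_nth) auto
  let ?f = "the_inv_into {..<n} ((!) zs)"
  have f: "?f (zs ! i) = i" if "i < n" for i using the_inv_into_f_f[OF inj] that by simp
  have "inj_on ?f (pverts G)" unfolding G' by (rule inj_on_the_inv_into[OF inj])
  moreover have "pverts H = ?f ` pverts G" unfolding G' image_image H(2) using f by force
  moreover have "parcs H = map_prod ?f ?f ` parcs G"
  proof -
    have "map_prod ?f ?f (map_prod ((!) zs) ((!) zs) a) = a" if "a \<in> parcs H" for a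
      using H.arc_fst_in_verts[OF that] H.arc_snd_in_verts[OF that] H(2) f by (cases a) auto
    then show ?thesis unfolding G' image_image by force
  qed
  ultimately show "\<exists>f. inj_on f (pverts G) \<and> pverts H = f ` pverts G \<and>
    parcs H = map_prod f f ` parcs G" by blast
qed

lemma pair_graph_cycle_graph:
  assumes "2 \<le> n"
  shows "pair_graph (cycle_graph n)"
proof -
  have "finite (parcs (cycle_graph n))"
    by (rule finite_subset[of _ "{..<n} \<times> {..<n}"]) (auto simp: cycle_graph_def)
  moreover have ne: "Suc i mod n \<noteq> i" for i
  proof
    assume "Suc i mod n = i"
    then have "i < n" "Suc i mod n = i" using assms by (metis mod_less_divisor less_le_trans pos2, simp)
    then show False using assms by (cases "Suc i = n") auto
  qed
  ultimately show ?thesis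
    by unfold_locales
      (auto simp: cycle_graph_def symmetric_def ne ne[symmetric] intro!: symI)
qed

lemma pair_wf_path_graph: "pair_wf_digraph (path_graph n)"
  by unfold_locales (auto simp: path_graph_def)

lemma pair_wf_image_graph: "pair_wf_digraph H \<Longrightarrow> pair_wf_digraph (image_graph zs H)"
  by unfold_locales
    (auto simp: image_graph_def dest: pair_wf_digraph.in_arcsD1 pair_wf_digraph.in_arcsD2)

lemma pverts_image_cycle_graph:
  "length zs = n \<Longrightarrow> pverts (image_graph zs (cycle_graph n)) = set zs"
  by (auto simp: image_graph_def cycle_graph_def in_set_conv_nth)

lemma parcs_image_graph_iff:
  "(a, b) \<in> parcs (image_graph zs H) \<longleftrightarrow> (\<exists>i j. (i, j) \<in> parcs H \<and> a = zs ! i \<and> b = zs ! j)"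
  by (auto simp: image_graph_def intro: rev_image_eqI)

lemma parcs_image_cycle_graph:
  "(a, b) \<in> parcs (image_graph zs (cycle_graph n)) \<longleftrightarrow>
    (\<exists>i<n. (a = zs ! i \<and> b = zs ! (Suc i mod n)) \<or> (b = zs ! i \<and> a = zs ! (Suc i mod n)))"
proof -
  have arc: "(i, j) \<in> parcs (cycle_graph n) \<longleftrightarrow> i < n \<and> j = Suc i mod n \<or> j < n \<and> i = Suc j mod n"
    for i j
    by (cases n) (auto simp: cycle_graph_def)
  show ?thesis (is "?A \<longleftrightarrow> ?B")
  proof
    assume ?A
    then obtain i j where ij: "(i, j) \<in> parcs (cycle_graph n)" "a = zs ! i" "b = zs ! j"
      unfolding parcs_image_graph_iff by blast
    from ij(1) show ?B unfolding arc
    proof (elim disjE conjE)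
      assume "i < n" "j = Suc i mod n"
      then show ?B using ij by (intro exI[of _ i]) simp
    next
      assume "j < n" "i = Suc j mod n"
      then show ?B using ij by (intro exI[of _ j]) simp
    qed
  next
    assume ?B
    then obtain i where i: "i < n"
      and ab: "(a = zs ! i \<and> b = zs ! (Suc i mod n)) \<or> (b = zs ! i \<and> a = zs ! (Suc i mod n))"
      by blast
    have "(i, Suc i mod n) \<in> parcs (cycle_graph n)" "(Suc i mod n, i) \<in> parcs (cycle_graph n)"
      using i arc by simp_all
    then show ?A using ab unfolding parcs_image_graph_iff by blast
  qed
qed

lemma cycle_list_nth:
  assumes "cycle_list E zs" "i < length zs"
  shows "(zs ! i, zs ! (Suc i mod length zs)) \<in> E"
proof (cases "Suc i < length zs")
  case True
  then show ?thesis using assms by (auto simp: cycle_list_def walk_list_nth)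
next
  case False
  then have "Suc i = length zs" using assms by simp
  then show ?thesis
    using assms by (cases zs rule: rev_cases) (auto simp: cycle_list_def hd_conv_nth)
qed

text \<open>This links the two notions of a cycle: the lists of the combinatorial arguments and the
  subgraphs isomorphic to a \<open>cycle_graph\<close>, by which cacti are defined.\<close>

lemma cycle_list_iff:
  assumes "sym E" "distinct zs" "3 \<le> length zs"
  shows "cycle_list E zs \<longleftrightarrow> parcs (image_graph zs (cycle_graph (length zs))) \<subseteq> E"
proof
  assume c: "cycle_list E zs"
  show "parcs (image_graph zs (cycle_graph (length zs))) \<subseteq> E"
    by (rule subrelI) (use cycle_list_nth[OF c] symD[OF assms(1)] in \<open>metis parcs_image_cycle_graph\<close>)
next
  assume *: "parcs (image_graph zs (cycle_graph (length zs))) \<subseteq> E"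
  have i: "(zs ! i, zs ! (Suc i mod length zs)) \<in> E" if "i < length zs" for i
    using * that parcs_image_cycle_graph[of _ _ zs "length zs"] by blast
  have "walk_list E zs" unfolding walk_list_nth
  proof (intro allI impI)
    fix i assume "Suc i < length zs"
    then show "(zs ! i, zs ! Suc i) \<in> E" using i[of i] by simp
  qed
  moreover have "(last zs, hd zs) \<in> E"
  proof -
    have "zs \<noteq> []" "Suc (length zs - 1) = length zs" using assms by auto
    then show ?thesis using i[of "length zs - 1"] by (simp add: last_conv_nth hd_conv_nth)
  qed
  ultimately show "cycle_list E zs" using assms by (simp add: cycle_list_def)
qed

lemma is_cycle_image_graph:
  assumes "distinct zs" "3 \<le> length zs"
  shows "is_cycle (image_graph zs (cycle_graph (length zs)))"
proof -
  interpret C: pair_graph "cycle_graph (length zs)" using assms by (intro pair_graph_cycle_graph) simp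
  have "digraph_iso (with_proj (image_graph zs (cycle_graph (length zs))))
    (with_proj (cycle_graph (length zs)))"
    using digraph_iso_image_graph_iff[OF pair_wf_image_graph[OF C.pair_wf_digraph] C.pair_wf_digraph]
      assms(1) by (auto simp: cycle_graph_def)
  then show ?thesis using assms(2) by (auto simp: is_cycle_def)
qed

lemma subgraph_pair_iff:
  assumes "pair_wf_digraph H" "pair_wf_digraph G"
  shows "subgraph (with_proj H) (with_proj G) \<longleftrightarrow> pverts H \<subseteq> pverts G \<and> parcs H \<subseteq> parcs G"
proof -
  interpret H: pair_wf_digraph H by fact
  interpret G: pair_wf_digraph G by fact
  show ?thesis using H.wf_digraph G.wf_digraph by (auto simp: subgraph_def)
qed

context pair_graph
begin

lemma sym_parcs: "sym (parcs G)"
  using arcs_symmetric by (intro symI)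

lemma subgraph_cycle_list:
  assumes "cycle_list (parcs G) zs"
  shows "subgraph (with_proj (image_graph zs (cycle_graph (length zs)))) (with_proj G)"
proof -
  have zs: "distinct zs" "3 \<le> length zs" using assms by (auto simp: cycle_list_def)
  interpret C: pair_graph "cycle_graph (length zs)" using zs by (intro pair_graph_cycle_graph) simp
  have "set zs \<subseteq> pverts G"
  proof
    fix z assume "z \<in> set zs"
    then show "z \<in> pverts G" using cycle_list_nth[OF assms] in_arcsD1 by (metis in_set_conv_nth)
  qed
  then show ?thesis
    using assms cycle_list_iff[OF sym_parcs zs]
    by (simp add: subgraph_pair_iff pair_wf_image_graph C.pair_wf_digraph pair_wf_digraph
        pverts_image_cycle_graph)
qed

lemma degree_eq: "out_degree G v = card {u. (v, u) \<in> parcs G}"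
proof -
  have "out_arcs G v = Pair v ` {u. (v, u) \<in> parcs G}" by (auto simp: out_arcs_def)
  then show ?thesis by (simp add: out_degree_def card_image inj_on_def)
qed

text \<open>The distance is an infimum of walk lengths in the extended reals. As lengths are
  integers, distance at most 2 means that there is a walk with at most two arcs, and such walks can
  be listed outright.\<close>

lemma parcs_square:
  "(u, v) \<in> parcs (square G) \<longleftrightarrow> u \<in> pverts G \<and> v \<in> pverts G \<and> square_adj (parcs G) (pverts G) u v"
proof -
  have cost: "awalk_cost (\<lambda>_. 1) p = real (length p)" for p :: "('a \<times> 'a) list"
    by (induction p) auto
  have mu: "\<mu> (\<lambda>_. 1) u v = (INF p\<in>{p. awalk u p v}. ereal (real (length p)))"
    by (simp add: \<mu>_def cost)
  have le2: "\<mu> (\<lambda>_. 1) u v \<le> 2 \<longleftrightarrow> (\<exists>p. awalk u p v \<and> length p \<le> 2)"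
  proof
    assume "\<mu> (\<lambda>_. 1) u v \<le> 2"
    \<comment> \<open>Passing to the strict bound 3 avoids showing that the infimum is attained:
      some walk has length below 3, hence at most 2.\<close>
    then have "\<mu> (\<lambda>_. 1) u v < ereal 3" by (rule le_less_trans) simp
    then obtain p where "awalk u p v" "real (length p) < 3" unfolding mu INF_less_iff by auto
    then show "\<exists>p. awalk u p v \<and> length p \<le> 2" by (intro exI[of _ p]) auto
  next
    assume "\<exists>p. awalk u p v \<and> length p \<le> 2"
    then obtain p where p: "awalk u p v" "length p \<le> 2" by blast
    have "\<mu> (\<lambda>_. 1) u v \<le> ereal (real (length p))" unfolding mu using p by (intro INF_lower) auto
    also have "\<dots> \<le> ereal 2" using p by simp
    finally show "\<mu> (\<lambda>_. 1) u v \<le> 2" by simp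
  qed
  have ge1: "1 \<le> \<mu> (\<lambda>_. 1) u v \<longleftrightarrow> u \<noteq> v" if "u \<in> pverts G"
  proof
    assume *: "1 \<le> \<mu> (\<lambda>_. 1) u v"
    show "u \<noteq> v"
    proof
      assume "u = v"
      then have "awalk u [] v" using that by (simp add: awalk_Nil_iff)
      then have "\<mu> (\<lambda>_. 1) u v \<le> ereal (real (length ([] :: ('a \<times> 'a) list)))"
        unfolding mu by (intro INF_lower) auto
      then show False using * by (metis ereal_less_eq(3) list.size(3) of_nat_0
            one_ereal_def order_trans zero_less_one linorder_not_le)
    qed
  next
    assume "u \<noteq> v"
    show "1 \<le> \<mu> (\<lambda>_. 1) u v" unfolding mu
    proof (intro INF_greatest)
      fix p assume "p \<in> {p. awalk u p v}"
      then have "p \<noteq> []" using \<open>u \<noteq> v\<close> by (auto simp: awalk_Nil_iff)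
      then have "1 \<le> real (length p)" by (cases p) auto
      then show "1 \<le> ereal (real (length p))" by (simp add: one_ereal_def)
    qed
  qed
  have "(\<exists>p. awalk u p v \<and> length p \<le> 2) \<longleftrightarrow>
    u = v \<or> (u, v) \<in> parcs G \<or> (\<exists>z. (u, z) \<in> parcs G \<and> (z, v) \<in> parcs G)"
    if uv: "u \<in> pverts G" "v \<in> pverts G"
  proof
    assume "\<exists>p. awalk u p v \<and> length p \<le> 2"
    then obtain p where p: "awalk u p v" "length p \<le> 2" by blast
    then have "length p = 0 \<or> length p = 1 \<or> length p = 2" by linarith
    then show "u = v \<or> (u, v) \<in> parcs G \<or> (\<exists>z. (u, z) \<in> parcs G \<and> (z, v) \<in> parcs G)"
      using p(1) by (auto simp: length_Suc_conv numeral_2_eq_2 awalk_Cons_iff awalk_Nil_iff)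
  next
    assume "u = v \<or> (u, v) \<in> parcs G \<or> (\<exists>z. (u, z) \<in> parcs G \<and> (z, v) \<in> parcs G)"
    then consider "u = v" | "(u, v) \<in> parcs G" | z where "(u, z) \<in> parcs G" "(z, v) \<in> parcs G" by blast
    then show "\<exists>p. awalk u p v \<and> length p \<le> 2"
    proof cases
      case 1
      then show ?thesis using uv by (intro exI[of _ "[]"]) (simp add: awalk_Nil_iff)
    next
      case 2
      then show ?thesis using uv by (intro exI[of _ "[(u, v)]"]) (simp add: awalk_Cons_iff awalk_Nil_iff)
    next
      case 3
      then show ?thesis using uv
        by (intro exI[of _ "[(u, z), (z, v)]"]) (simp add: awalk_Cons_iff awalk_Nil_iff)
    qed
  qed
  moreover have "(\<exists>z. (u, z) \<in> parcs G \<and> (z, v) \<in> parcs G) \<longleftrightarrow>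
    (\<exists>z\<in>pverts G. (u, z) \<in> parcs G \<and> (z, v) \<in> parcs G)"
    using in_arcsD1 by blast
  ultimately show ?thesis using le2 ge1 by (auto simp: square_def graph_dist_def square_adj_def)
qed

lemma colorable_square_iff:
  "colorable (square G) k \<longleftrightarrow> (\<exists>c. square_coloring (parcs G) (pverts G) (\<lambda>_. {..<k}) c)"
proof -
  have V: "pverts (square G) = pverts G" by (simp add: square_def)
  show ?thesis
    unfolding colorable_def proper_coloring_def square_coloring_def parcs_square V lessThan_iff
    by blast
qed

lemma choosable_squareI:
  assumes "\<And>L :: 'a \<Rightarrow> nat set. (\<And>v. v \<in> pverts G \<Longrightarrow> k \<le> card (L v)) \<Longrightarrow>
    \<exists>c. square_coloring (parcs G) (pverts G) L c"
  shows "choosable (square G) k"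
proof -
  have V: "pverts (square G) = pverts G" by (simp add: square_def)
  show ?thesis
    unfolding choosable_def proper_coloring_def parcs_square V
  proof (intro allI impI)
    fix L :: "'a \<Rightarrow> nat set"
    assume "\<forall>v\<in>pverts G. finite (L v) \<and> k \<le> card (L v)"
    then obtain c where "square_coloring (parcs G) (pverts G) L c" using assms by blast
    then show "\<exists>c. (\<forall>u v. u \<in> pverts G \<and> v \<in> pverts G \<and> square_adj (parcs G) (pverts G) u v \<longrightarrow>
      c u \<noteq> c v) \<and> (\<forall>v\<in>pverts G. c v \<in> L v)"
      unfolding square_coloring_def by (intro exI[of _ c]) blast
  qed
qed

end

lemma choosable_imp_colorable: "choosable H k \<Longrightarrow> colorable H k"
  unfolding choosable_def colorable_def by (drule spec[of _ "\<lambda>_. {..<k}"]) simp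

text \<open>Equal lists are a special case, so a lower bound for colorings also bounds choosability;
  one upper bound for lists and one lower bound for colorings fix both numbers.\<close>

lemma choice_chromatic_eqI:
  assumes "choosable H l" "\<And>k. colorable H k \<Longrightarrow> l \<le> k"
  shows "choice_number H = l" "chromatic_number H = l"
  unfolding choice_number_def chromatic_number_def
  using assms choosable_imp_colorable by (auto intro!: Least_equality)

section \<open>Lower bounds and small degrees\<close>

lemma rtrancl_first_hit:
  assumes "(w, z) \<in> F\<^sup>*" "w \<notin> S" "z \<in> S"
  obtains y v where "y \<notin> S" "v \<in> S" "(y, v) \<in> F" "(w, y) \<in> (outside F S)\<^sup>*"
proof -
  have "\<exists>y v. y \<notin> S \<and> v \<in> S \<and> (y, v) \<in> F \<and> (w, y) \<in> (outside F S)\<^sup>*"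
    using assms(1,2)
  proof (induction rule: converse_rtrancl_induct)
    case base
    then show ?case using assms(3) by simp
  next
    case (step w w')
    show ?case
    proof (cases "w' \<in> S")
      case True
      then show ?thesis using step.hyps(1) step.prems by blast
    next
      case False
      then obtain y v where y: "y \<notin> S" "v \<in> S" "(y, v) \<in> F" "(w', y) \<in> (outside F S)\<^sup>*"
        using step.IH by blast
      have "(w, w') \<in> outside F S" using step.hyps(1) step.prems False by (simp add: outside_def)
      then show ?thesis using y by (meson converse_rtrancl_into_rtrancl)
    qed
  qed
  then show thesis using that by blast
qed

text \<open>Connectedness is defined through the symmetric closure \<open>mk_symmetric\<close>,
  which adds no arcs between vertices to a symmetric relation.\<close>

lemma connected_imp_rtrancl:
  assumes "connected H" "sym (arcs_ends H)" "u \<in> verts H" "v \<in> verts H"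
  shows "(u, v) \<in> (arcs_ends H)\<^sup>*"
proof -
  have "parcs (mk_symmetric H) \<subseteq> arcs_ends H"
    using assms(2) by (auto simp: mk_symmetric_def arcs_ends_conv sym_def) 
  moreover have "u \<rightarrow>\<^sup>*\<^bsub>with_proj (mk_symmetric H)\<^esub> v"
    using assms by (auto simp: connected_def strongly_connected_def mk_symmetric_def)
  then have "(u, v) \<in> (parcs (mk_symmetric H))\<^sup>*" using reachable_rtranclI by fastforce
  ultimately show ?thesis using rtrancl_mono by blast
qed

lemma walk_list_connected:
  assumes H: "wf_digraph H" and xs: "walk_list (arcs_ends H) xs" "set xs = verts H" "xs \<noteq> []"
  shows "connected H"
proof -
  interpret H: wf_digraph H by fact
  interpret S: pair_wf_digraph "mk_symmetric H" by (rule H.wellformed_mk_symmetric)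
  let ?R = "parcs (mk_symmetric H)"
  have sub: "arcs_ends H \<subseteq> ?R" by (auto simp: mk_symmetric_def arcs_ends_conv)
  have "sym ?R" by (intro symI) (auto simp: mk_symmetric_def)
  then have sR: "sym (?R\<^sup>*)" by (rule sym_rtrancl)
  have hd: "(hd xs, z) \<in> ?R\<^sup>*" if z: "z \<in> set xs" for z
  proof -
    obtain ps qs where "xs = ps @ z # qs" using split_list[OF z] by blast
    then have p: "xs = (ps @ [z]) @ qs" by simp
    have "walk_list (arcs_ends H) ((ps @ [z]) @ qs)" using xs(1) by (simp only: p)
    then have "walk_list (arcs_ends H) (ps @ [z])" by (simp only: walk_list_append[of _ "ps @ [z]" qs])
    then have "(hd (ps @ [z]), last (ps @ [z])) \<in> (arcs_ends H)\<^sup>*" by (intro walk_list_rtrancl) auto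
    moreover have "hd (ps @ [z]) = hd xs" unfolding p by (simp add: hd_append)
    ultimately show ?thesis using rtrancl_mono[OF sub] by auto
  qed
  have "(u, v) \<in> ?R\<^sup>*" if "u \<in> set xs" "v \<in> set xs" for u v
    using symD[OF sR hd[OF that(1)]] hd[OF that(2)] by (rule rtrancl_trans)
  moreover have V: "pverts (mk_symmetric H) = set xs" using xs(2) by (simp add: mk_symmetric_def)
  ultimately show ?thesis
    unfolding connected_def strongly_connected_def
    using xs(3) S.reachable_conv' by auto
qed

context cactus_relation
begin

text \<open>
  A larger 2-connected subgraph would contain a vertex outside the cycle that stays connected to
  the cycle after deletion of its first contact point, giving an ear.
\<close>

lemma cycle_separates:
  assumes cyc: "cycle_list E zs" and F: "F \<subseteq> E" and w: "w \<notin> set zs" and z: "z \<in> set zs"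
    and wz: "(w, z) \<in> F\<^sup>*"
    and del: "\<And>v. v \<in> set zs \<Longrightarrow> \<exists>z'\<in>set zs - {v}. (w, z') \<in> {(a, b) \<in> F. a \<noteq> v \<and> b \<noteq> v}\<^sup>*"
  shows False
proof -
  let ?S = "set zs"
  obtain y v where y: "y \<notin> ?S" "v \<in> ?S" "(y, v) \<in> F" "(w, y) \<in> (outside F ?S)\<^sup>*"
    using rtrancl_first_hit[OF wz w z] by blast
  let ?F = "{(a, b) \<in> F. a \<noteq> v \<and> b \<noteq> v}"
  obtain z' where z': "z' \<in> ?S" "(w, z') \<in> ?F\<^sup>*" using del[OF y(2)] by blast
  obtain y' v' where y': "y' \<notin> ?S" "v' \<in> ?S" "(y', v') \<in> ?F" "(w, y') \<in> (outside ?F ?S)\<^sup>*"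
    using rtrancl_first_hit[OF z'(2) w z'(1)] by blast
  have sub: "outside F ?S \<subseteq> outside E ?S" "outside ?F ?S \<subseteq> outside E ?S"
    using F by (auto simp: outside_def)
  have "(w, y) \<in> (outside E ?S)\<^sup>*" using subsetD[OF rtrancl_mono[OF sub(1)] y(4)] .
  then have "(y, w) \<in> (outside E ?S)\<^sup>*" using symD[OF sym_outside_rtrancl[OF sym_E]] by blast
  moreover have "(w, y') \<in> (outside E ?S)\<^sup>*" using subsetD[OF rtrancl_mono[OF sub(2)] y'(4)] .
  ultimately have "(y, y') \<in> (outside E ?S)\<^sup>*" by (rule rtrancl_trans)
  moreover have "(v, y) \<in> E" "(y', v') \<in> E" using y(3) y'(3) F E_sym by auto
  ultimately have "v = v'"
    using separatedD[OF separated_cycle[OF cyc] y(2) y'(2) y(1) y'(1)] by blast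
  then show False using y'(3) by auto
qed

section \<open>Cacti of maximum degree at most two\<close>

lemma cycle_list_neighbors:
  assumes "cycle_list E zs" "v \<in> set zs"
  obtains a b where "a \<in> set zs" "b \<in> set zs" "a \<noteq> b" "(v, a) \<in> E" "(v, b) \<in> E"
proof -
  define n where "n = length zs"
  have n: "3 \<le> n" "distinct zs" using assms(1) by (auto simp: cycle_list_def n_def)
  obtain i where i: "i < n" "v = zs ! i" using assms(2) by (auto simp: in_set_conv_nth n_def)
  define p where "p = (if i = 0 then n - 1 else i - 1)"
  have p: "p < n" "Suc p mod n = i" using i n by (auto simp: p_def)
  have s: "Suc i mod n < n" "Suc i mod n \<noteq> p"
  proof -
    show "Suc i mod n < n" using n by auto
    show "Suc i mod n \<noteq> p"
      using i n by (cases "Suc i = n") (auto simp: p_def split: if_splits)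
  qed
  show thesis
  proof (rule that[of "zs ! (Suc i mod n)" "zs ! p"])
    show "(v, zs ! (Suc i mod n)) \<in> E"
      using cycle_list_nth[OF assms(1), of i] i unfolding n_def by simp
    show "(v, zs ! p) \<in> E"
      using cycle_list_nth[OF assms(1), of p] p i E_sym unfolding n_def by simp
    show "zs ! (Suc i mod n) \<noteq> zs ! p"
      using nth_eq_iff_index_eq[OF n(2)] s p(1) unfolding n_def by blast
  qed (use s p n_def in auto)
qed

lemma degree_ge_3:
  assumes "(v, a) \<in> E" "(v, b) \<in> E" "(v, c) \<in> E" "a \<noteq> b" "a \<noteq> c" "b \<noteq> c"
  shows "3 \<le> card {u. (v, u) \<in> E}"
proof -
  have "card {a, b, c} \<le> card {u. (v, u) \<in> E}"
    using assms(1-3) finite_neighbors by (intro card_mono) auto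
  then show ?thesis using assms(4-6) by simp
qed

text \<open>Each vertex of the cycle has two neighbors on it and therefore none elsewhere;
  connectivity does the rest.\<close>

lemma cycle_list_spanning:
  assumes deg: "\<And>v. v \<in> V \<Longrightarrow> card {u. (v, u) \<in> E} \<le> 2" and cyc: "cycle_list E zs"
  shows "set zs = V"
proof
  show sub: "set zs \<subseteq> V" using cycle_list_neighbors[OF cyc] E_subset by blast
  show "V \<subseteq> set zs"
  proof
    fix w assume w: "w \<in> V"
    have "hd zs \<in> set zs" using cyc by (cases zs) (auto simp: cycle_list_def)
    then have "(hd zs, w) \<in> E\<^sup>*" using connected_E sub w by blast
    then show "w \<in> set zs"
    proof (induction rule: rtrancl_induct)
      case base
      show ?case by fact
    next
      case (step y z)
      obtain a b where ab: "a \<in> set zs" "b \<in> set zs" "a \<noteq> b" "(y, a) \<in> E" "(y, b) \<in> E"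
        using cycle_list_neighbors[OF cyc step.IH] by blast
      show ?case
      proof (rule ccontr)
        assume "z \<notin> set zs"
        then have "3 \<le> card {u. (y, u) \<in> E}" using degree_ge_3[OF ab(4,5) step.hyps(2) ab(3)] ab by blast
        then show False using deg[of y] step.IH sub by fastforce
      qed
    qed
  qed
qed

text \<open>The last clause excludes chords. It is phrased by splittings instead of indices because
  appending a vertex and reversing the list act directly on splittings.\<close>

definition induced_path :: "'a list \<Rightarrow> bool" where
  "induced_path xs \<longleftrightarrow> distinct xs \<and> xs \<noteq> [] \<and> walk_list E xs \<and>
    (\<forall>ps qs rs a b. xs = ps @ a # qs @ b # rs \<longrightarrow> (a, b) \<in> E \<longrightarrow> qs = [])"

lemma induced_pathD: "induced_path xs \<Longrightarrow> xs = ps @ a # qs @ b # rs \<Longrightarrow> (a, b) \<in> E \<Longrightarrow> qs = []"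
  unfolding induced_path_def by blast

lemma induced_path_snoc:
  assumes xs: "induced_path xs" and w: "w \<notin> set xs" "(last xs, w) \<in> E"
    and nbr: "\<And>u. u \<in> set xs \<Longrightarrow> (u, w) \<in> E \<Longrightarrow> u = last xs"
  shows "induced_path (xs @ [w])"
  unfolding induced_path_def
proof (intro conjI allI impI)
  show "distinct (xs @ [w])" "walk_list E (xs @ [w])"
    using xs w by (auto simp: induced_path_def walk_list_append)
  fix ps qs rs a b
  assume eq: "xs @ [w] = ps @ a # qs @ b # rs" and ab: "(a, b) \<in> E"
  show "qs = []"
  proof (cases rs rule: rev_cases)
    case Nil
    then have "xs @ [w] = (ps @ a # qs) @ [b]" using eq by simp
    then have x: "xs = ps @ a # qs" "b = w" by (auto simp only: append1_eq_conv)
    then have "a = last xs" using nbr ab by simp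
    then show ?thesis using x xs by (cases qs rule: rev_cases) (auto simp: induced_path_def)
  next
    case (snoc rs' y)
    then have "xs @ [w] = (ps @ a # qs @ b # rs') @ [y]" using eq by simp
    then have "xs = ps @ a # qs @ b # rs'" by blast
    then show ?thesis using induced_pathD[OF xs _ ab] by blast
  qed
qed simp

lemma induced_path_rev:
  assumes "induced_path xs"
  shows "induced_path (rev xs)"
  unfolding induced_path_def
proof (intro conjI allI impI)
  show "distinct (rev xs)" "rev xs \<noteq> []" "walk_list E (rev xs)"
    using assms walk_list_rev[OF sym_E] by (auto simp: induced_path_def)
  fix ps qs rs a b
  assume eq: "rev xs = ps @ a # qs @ b # rs" and ab: "(a, b) \<in> E"
  have "xs = rev (rev xs)" by simp
  also have "\<dots> = rev rs @ b # rev qs @ a # rev ps" unfolding eq by simp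
  finally have "rev qs = []" using induced_pathD[OF assms _ E_sym[OF ab]] by blast
  then show "qs = []" by simp
qed

text \<open>The degree bound restricts the growth: a new vertex can only be attached at an end of a
  path, which reversal makes the last vertex, and never to a cycle; a pendant cycle uses up both
  neighbors of its attaching vertex, so \<open>S\<close> consists of that vertex alone.\<close>

lemma max_degree_2_cases:
  assumes deg: "\<And>v. v \<in> V \<Longrightarrow> card {u. (v, u) \<in> E} \<le> 2" and ne: "V \<noteq> {}"
  shows "(\<exists>xs. induced_path xs \<and> set xs = V) \<or> (\<exists>zs. cycle_list E zs \<and> set zs = V)"
proof -
  obtain r where r: "r \<in> V" using ne by blast
  have deg3: False if "v \<in> V" "(v, a) \<in> E" "(v, b) \<in> E" "(v, c) \<in> E" "a \<noteq> b" "a \<noteq> c" "b \<noteq> c" for v a b c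
    using degree_ge_3[OF that(2-7)] deg[OF that(1)] by linarith
  show ?thesis
  proof (rule cactus_induct[OF r])
    show "(\<exists>xs. induced_path xs \<and> set xs = {r}) \<or> (\<exists>zs. cycle_list E zs \<and> set zs = {r})"
      by (intro disjI1 exI[of _ "[r]"]) (auto simp: induced_path_def Cons_eq_append_conv)
  next
    fix S v w
    assume a: "S \<subseteq> V" "v \<in> S" "w \<in> V - S" "(v, w) \<in> E"
      and nbr: "\<And>u. u \<in> S \<Longrightarrow> (u, w) \<in> E \<Longrightarrow> u = v"
      and IH: "(\<exists>xs. induced_path xs \<and> set xs = S) \<or> (\<exists>zs. cycle_list E zs \<and> set zs = S)"
    have v: "v \<in> V" using a by blast
    from IH have "\<exists>xs. induced_path xs \<and> set xs = S \<and> last xs = v"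
    proof
      assume "\<exists>zs. cycle_list E zs \<and> set zs = S"
      then obtain zs where zs: "cycle_list E zs" "set zs = S" by blast
      obtain x y where "x \<in> S" "y \<in> S" "x \<noteq> y" "(v, x) \<in> E" "(v, y) \<in> E"
        using cycle_list_neighbors[OF zs(1)] zs(2) a(2) by metis
      then show ?thesis using deg3[OF v, of x y w] a by blast
    next
      assume "\<exists>xs. induced_path xs \<and> set xs = S"
      then obtain xs where xs: "induced_path xs" "set xs = S" by blast
      obtain ps qs where p: "xs = ps @ v # qs" using a(2) xs(2) by (metis split_list)
      have "ps = [] \<or> qs = []"
      proof (rule ccontr)
        assume "\<not> ?thesis"
        then have n: "ps \<noteq> []" "qs \<noteq> []" by auto
        have "walk_list E (ps @ v # qs)" "distinct (ps @ v # qs)"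
          using xs(1) p by (auto simp: induced_path_def)
        then have "(last ps, v) \<in> E" "(v, hd qs) \<in> E" "last ps \<noteq> hd qs"
          using n by (auto simp: walk_list_append walk_list_Cons)
            (metis disjoint_iff hd_in_set last_in_set)
        moreover have "last ps \<in> S" "hd qs \<in> S" using n xs(2) p by auto
        ultimately show False using deg3[OF v, of "last ps" "hd qs" w] a E_sym by blast
      qed
      then show ?thesis
      proof
        assume "qs = []"
        then show ?thesis using xs p by (intro exI[of _ xs]) auto
      next
        assume "ps = []"
        then show ?thesis using xs p induced_path_rev[OF xs(1)] by (intro exI[of _ "rev xs"]) auto
      qed
    qed
    then obtain xs where xs: "induced_path xs" "set xs = S" "last xs = v" by blast
    have "induced_path (xs @ [w])"
    proof (rule induced_path_snoc[OF xs(1)])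
      show "w \<notin> set xs" "(last xs, w) \<in> E" using xs a by simp_all
      show "u = last xs" if "u \<in> set xs" "(u, w) \<in> E" for u using nbr[of u] that xs by simp
    qed
    then show "(\<exists>xs. induced_path xs \<and> set xs = insert w S) \<or>
        (\<exists>zs. cycle_list E zs \<and> set zs = insert w S)"
      using xs by (intro disjI1 exI[of _ "xs @ [w]"]) auto
  next
    fix S v xs
    assume a: "S \<subseteq> V" "v \<in> S" "set xs \<subseteq> V - S" "cycle_list E (v # xs)"
      and IH: "(\<exists>xs. induced_path xs \<and> set xs = S) \<or> (\<exists>zs. cycle_list E zs \<and> set zs = S)"
    have v: "v \<in> V" using a by blast
    obtain x y where xy: "x \<in> set (v # xs)" "y \<in> set (v # xs)" "x \<noteq> y" "(v, x) \<in> E" "(v, y) \<in> E"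
      using cycle_list_neighbors[OF a(4), of v] by auto
    then have "x \<in> set xs" "y \<in> set xs" using irrefl_E by auto
    then have no: False if "(v, u) \<in> E" "u \<in> S" for u
      using deg3[OF v xy(4,5) that(1) xy(3)] that(2) a(3) by blast
    have "S = {v}"
    proof (rule ccontr)
      assume "S \<noteq> {v}"
      from IH show False
      proof
        assume "\<exists>zs. cycle_list E zs \<and> set zs = S"
        then show False using cycle_list_neighbors no a(2) by metis
      next
        assume "\<exists>xs. induced_path xs \<and> set xs = S"
        then obtain xs where xs: "induced_path xs" "set xs = S" by blast
        obtain ps qs where p: "xs = ps @ v # qs" using a(2) xs(2) by (metis split_list)
        have "ps \<noteq> [] \<or> qs \<noteq> []" using p xs(2) \<open>S \<noteq> {v}\<close> by auto
        moreover have "walk_list E (ps @ v # qs)" using xs(1) p by (auto simp: induced_path_def)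
        ultimately have "ps \<noteq> [] \<and> (last ps, v) \<in> E \<or> qs \<noteq> [] \<and> (v, hd qs) \<in> E"
          by (auto simp: walk_list_append walk_list_Cons)
        then show False using no[of "last ps"] no[of "hd qs"] E_sym xs(2) p by auto
      qed
    qed
    then show "(\<exists>ys. induced_path ys \<and> set ys = S \<union> set xs) \<or>
        (\<exists>zs. cycle_list E zs \<and> set zs = S \<union> set xs)"
      using a(4) by (intro disjI2 exI[of _ "v # xs"]) auto
  qed
qed

text \<open>A cycle would be spanning and give two neighbors to the last vertex of the path, whose
  only possible neighbor is its predecessor.\<close>

lemma spanning_induced_path_no_cycle:
  assumes xs: "induced_path xs" "set xs = V"
    and deg: "\<And>v. v \<in> V \<Longrightarrow> card {u. (v, u) \<in> E} \<le> 2"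
  shows "\<not> cycle_list E zs"
proof
  assume zs: "cycle_list E zs"
  have ne: "xs \<noteq> []" using xs by (simp add: induced_path_def)
  then obtain ys l where l: "xs = ys @ [l]" by (cases xs rule: rev_cases) auto
  have "l \<in> set zs" using cycle_list_spanning[OF deg zs] xs(2) l by auto
  then obtain a b where ab: "a \<noteq> b" "(l, a) \<in> E" "(l, b) \<in> E" using cycle_list_neighbors[OF zs] by metis
  have *: "u = last ys" if "(l, u) \<in> E" for u
  proof -
    have "u \<in> set ys" using that E_subset irrefl_E xs(2) l by auto
    then obtain ps qs where p: "ys = ps @ u # qs" by (metis split_list)
    then have "qs = []" using induced_pathD[OF xs(1), of ps u qs l "[]"] l E_sym[OF that] by simp
    then show ?thesis using p by simp
  qed
  show False using *[OF ab(2)] *[OF ab(3)] ab(1) by simp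
qed

lemma induced_path_arcs:
  assumes xs: "induced_path xs" and ij: "i < j" "j < length xs" "(xs ! i, xs ! j) \<in> E"
  shows "j = Suc i"
proof -
  obtain ps as bs where s: "xs = ps @ xs ! i # as @ xs ! j # bs" "length as = j - Suc i"
    using nth_split2[OF ij(1,2)] by metis
  have "as = []" using induced_pathD[OF xs s(1) ij(3)] .
  then show ?thesis using s(2) ij(1) by simp
qed

section \<open>Cliques of the square\<close>

lemma square_coloring_clique:
  fixes k :: nat
  assumes "square_coloring E V (\<lambda>_. {..<k}) c" "Q \<subseteq> V"
    and "\<And>u w. u \<in> Q \<Longrightarrow> w \<in> Q \<Longrightarrow> u \<noteq> w \<Longrightarrow> square_adj E V u w"
  shows "card Q \<le> k"
proof -
  have "inj_on c Q"
    using assms unfolding square_coloring_def inj_on_def by blast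
  moreover have "c ` Q \<subseteq> {..<k}" using assms(1,2) unfolding square_coloring_def by blast
  ultimately show ?thesis using card_inj_on_le[of c Q "{..<k}"] by simp
qed

lemma square_coloring_degree:
  fixes k :: nat
  assumes "square_coloring E V (\<lambda>_. {..<k}) c" "v \<in> V"
  shows "Suc (card {u. (v, u) \<in> E}) \<le> k"
proof -
  have "card (insert v {u. (v, u) \<in> E}) \<le> k"
  proof (rule square_coloring_clique[OF assms(1)])
    show "insert v {u. (v, u) \<in> E} \<subseteq> V" using assms(2) E_subset by auto
    show "square_adj E V u w" if "u \<in> insert v {u. (v, u) \<in> E}" "w \<in> insert v {u. (v, u) \<in> E}" "u \<noteq> w" for u w
      using that E_sym assms(2) unfolding square_adj_def by blast
  qed
  then show ?thesis using finite_neighbors irrefl_E by simp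
qed

lemma square_coloring_C5:
  fixes k :: nat
  assumes "square_coloring E V (\<lambda>_. {..<k}) c" "cycle_list E zs" "length zs = 5"
  shows "5 \<le> k"
proof -
  obtain x0 x1 x2 x3 x4 where zs: "zs = [x0, x1, x2, x3, x4]"
    using assms(3) by (auto simp: numeral_eq_Suc length_Suc_conv)
  have e: "(x0, x1) \<in> E" "(x1, x2) \<in> E" "(x2, x3) \<in> E" "(x3, x4) \<in> E" "(x4, x0) \<in> E"
    using assms(2) by (auto simp: cycle_list_def zs)
  then have e': "(x1, x0) \<in> E" "(x2, x1) \<in> E" "(x3, x2) \<in> E" "(x4, x3) \<in> E" "(x0, x4) \<in> E"
    using E_sym by blast+
  have V: "set zs \<subseteq> V" using e E_subset by (auto simp: zs)
  have "card (set zs) \<le> k"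
  proof (rule square_coloring_clique[OF assms(1) V])
    fix u w assume "u \<in> set zs" "w \<in> set zs" "u \<noteq> w"
    then show "square_adj E V u w"
      using e e' V unfolding square_adj_def zs by (auto simp del: bex_simps)
  qed
  moreover have "card (set zs) = 5"
    using assms(2,3) by (simp add: cycle_list_def distinct_card)
  ultimately show ?thesis by simp
qed

end

section \<open>Cycle blocks, cycles and paths\<close>

text \<open>For the cycle condition, the two paths from a to b are closed by the edge ab to
  subgraphs, which must coincide. Their common vertex set without a and b is the set of inner
  vertices of either path.\<close>

lemma cactus_imp_cactus_relation:
  assumes "cactus G"
  shows "cactus_relation (pverts G) (parcs G)"
proof -
  interpret pair_graph G using assms by (simp add: cactus_def)
  have uniq: "C = D" if "e \<in> parcs G" "is_cycle C" "subgraph C G" "e \<in> parcs C"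
    "is_cycle D" "subgraph D G" "e \<in> parcs D" for e and C D :: "'a pair_pre_digraph"
    using assms that unfolding cactus_def by blast
  have conn: "connected G" using assms by (simp add: cactus_def)
  show ?thesis
  proof
    show "finite (pverts G)" by (rule pair_finite_verts)
    show "parcs G \<subseteq> pverts G \<times> pverts G" by (auto dest: in_arcsD1 in_arcsD2)
    show "sym (parcs G)" by (rule sym_parcs)
    show "(a, a) \<notin> parcs G" for a using pair_no_loops[of "(a, a)"] by auto
    show "(a, b) \<in> (parcs G)\<^sup>*" if "a \<in> pverts G" "b \<in> pverts G" for a b
      using connected_imp_rtrancl[OF conn] sym_parcs that by simp
  next
    fix a b as bs
    assume ab: "(a, b) \<in> parcs G" and ne: "as \<noteq> []" "bs \<noteq> []"
      and w: "walk_list (parcs G) (a # as @ [b])" "walk_list (parcs G) (a # bs @ [b])"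
      and d: "distinct (a # as @ [b])" "distinct (a # bs @ [b])"
    have cyc: "cycle_list (parcs G) (a # cs @ [b])"
      if "cs \<noteq> []" "walk_list (parcs G) (a # cs @ [b])" "distinct (a # cs @ [b])" for cs
      using that arcs_symmetric[OF ab] by (cases cs) (auto simp: cycle_list_def)
    let ?C = "\<lambda>cs. image_graph (a # cs @ [b]) (cycle_graph (length (a # cs @ [b])))"
    have C: "is_cycle (?C cs) \<and> subgraph (?C cs) G \<and> (a, b) \<in> parcs (?C cs)"
      if c: "cycle_list (parcs G) (a # cs @ [b])" for cs
    proof -
      have "is_cycle (?C cs)"
        using c by (intro is_cycle_image_graph) (auto simp: cycle_list_def)
      \<comment> \<open>The edge ab is the closing arc: b has position
        \<open>Suc (length cs)\<close>, whose successor modulo the length is 0, the position of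
        a.\<close>
      moreover have "(a, b) \<in> parcs (?C cs)"
        unfolding parcs_image_cycle_graph
        by (rule exI[of _ "Suc (length cs)"]) (simp add: nth_append)
      ultimately show ?thesis using subgraph_cycle_list[OF c] by blast
    qed
    have "?C as = ?C bs"
      using uniq[OF ab] C[OF cyc[OF ne(1) w(1) d(1)]] C[OF cyc[OF ne(2) w(2) d(2)]] by blast
    then have "set (a # as @ [b]) = set (a # bs @ [b])"
      by (metis pverts_image_cycle_graph)
    moreover have "set as = set (a # as @ [b]) - {a, b}" "set bs = set (a # bs @ [b]) - {a, b}"
      using d by auto
    ultimately show "set as = set bs" by (simp only:)
  qed
qed

text \<open>Deleting v splits the list into \<open>ps\<close> and \<open>qs\<close>, and the walk
  \<open>qs @ ps\<close> over the closing arc still visits all other vertices.\<close>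

lemma two_connected_cycle:
  assumes "distinct zs" "3 \<le> length zs"
  shows "two_connected (with_proj (image_graph zs (cycle_graph (length zs))))"
proof -
  let ?B = "image_graph zs (cycle_graph (length zs))"
  interpret C: pair_graph "cycle_graph (length zs)" using assms by (intro pair_graph_cycle_graph) simp
  interpret B: pair_wf_digraph ?B by (rule pair_wf_image_graph[OF C.pair_wf_digraph])
  have V: "pverts ?B = set zs" by (rule pverts_image_cycle_graph) simp
  have symB: "sym (parcs ?B)"
    unfolding sym_def parcs_image_cycle_graph by blast
  have B: "pair_graph ?B"
  proof -
    have "finite (parcs ?B)" unfolding image_graph_def using C.pair_finite_arcs by simp
    moreover have "fst e \<noteq> snd e" if "e \<in> parcs ?B" for e
    proof -
      obtain a b where e: "e = (a, b)" by fastforce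
      then obtain i j where ij: "(i, j) \<in> parcs (cycle_graph (length zs))" "a = zs ! i" "b = zs ! j"
        using \<open>e \<in> parcs ?B\<close> parcs_image_graph_iff by metis
      have "i \<noteq> j" by (rule C.no_loops'[OF ij(1)])
      moreover have "i < length zs" "j < length zs" using ij(1) by (simp_all add: cycle_graph_def)
      ultimately show ?thesis using assms(1) ij(2,3) e by (simp add: nth_eq_iff_index_eq)
    qed
    ultimately show ?thesis
      using symB B.arc_fst_in_verts B.arc_snd_in_verts by unfold_locales (simp_all add: V symmetric_def)
  qed
  have cyc: "cycle_list (parcs ?B) zs" using cycle_list_iff[OF symB assms] by simp
  have conn: "connected (with_proj ?B)"
    using cyc assms by (intro walk_list_connected B.wf_digraph) (auto simp: cycle_list_def V)
  have del: "connected (pre_digraph.del_vert (with_proj ?B) v)" if v: "v \<in> set zs" for v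
  proof -
    obtain ps qs where z: "zs = ps @ v # qs" using split_list[OF v] by blast
    have w: "walk_list (parcs ?B) (ps @ [v] @ qs)" and l: "(last zs, hd zs) \<in> parcs ?B"
      using cyc z by (auto simp: cycle_list_def)
    have "walk_list (parcs ?B) (qs @ ps)"
    proof -
      have "walk_list (parcs ?B) ps" "walk_list (parcs ?B) qs"
        using w unfolding walk_list_append[of _ ps] walk_list_append[of _ "[v]"] by blast+
      moreover have "(last qs, hd ps) \<in> parcs ?B" if "qs \<noteq> []" "ps \<noteq> []"
        using l that by (simp add: z)
      ultimately show ?thesis by (simp add: walk_list_append)
    qed
    moreover have "set (qs @ ps) \<inter> {v} = {}" using assms(1) z by auto
    ultimately have w': "walk_list (outside (parcs ?B) {v}) (qs @ ps)" by (rule walk_list_outside)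
    have arcs: "arcs_ends (pre_digraph.del_vert (with_proj ?B) v) = outside (parcs ?B) {v}"
      by (auto simp: arcs_ends_conv pre_digraph.del_vert_def outside_def)
    have "verts (pre_digraph.del_vert (with_proj ?B) v) = set zs - {v}"
      by (simp add: pre_digraph.del_vert_def V)
    moreover have "set zs - {v} = set (qs @ ps)" using assms(1) unfolding z by auto
    ultimately have verts: "set (qs @ ps) = verts (pre_digraph.del_vert (with_proj ?B) v)" by simp
    have "qs @ ps \<noteq> []" using assms(2) z by auto
    then show ?thesis
      by (rule walk_list_connected[OF B.wf_digraph_del_vert w'[folded arcs] verts])
  qed
  show ?thesis
    unfolding two_connected_def
    using pair_graph.pair_graphD_graph[OF B] assms conn del by (simp add: V distinct_card)
qed

text \<open>Maximality has two cases. A larger subgraph on the same vertices would contain a chord.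
  A further vertex of a 2-connected subgraph would stay linked to the cycle after the deletion of
  any cycle vertex, against \<open>cycle_separates\<close>.\<close>

lemma cactus_cycle_is_block:
  assumes "cactus G" and cyc: "cycle_list (parcs G) zs"
  shows "is_block G (image_graph zs (cycle_graph (length zs)))"
proof -
  interpret pair_graph G using assms(1) by (simp add: cactus_def)
  interpret R: cactus_relation "pverts G" "parcs G" by (rule cactus_imp_cactus_relation[OF assms(1)])
  let ?B = "image_graph zs (cycle_graph (length zs))"
  have zs: "distinct zs" "3 \<le> length zs" using cyc by (auto simp: cycle_list_def)
  interpret C: pair_graph "cycle_graph (length zs)" using zs by (intro pair_graph_cycle_graph) simp
  have V: "pverts ?B = set zs" by (rule pverts_image_cycle_graph) simp
  have no: "\<not> (subgraph H (with_proj G) \<and> two_connected H)"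
    if H: "H \<noteq> with_proj ?B" "subgraph (with_proj ?B) H" for H
  proof
    assume "subgraph H (with_proj G) \<and> two_connected H"
    then have HG: "subgraph H (with_proj G)" and tc: "two_connected H" by auto
    interpret H: graph H using tc by (simp add: two_connected_def)
    have th: "tail H = fst" "head H = snd"
      using HG by (auto simp: subgraph_def compatible_def)
    have ends: "arcs_ends H = arcs H" by (auto simp: arcs_ends_conv th)
    have symH: "sym (arcs H)" using H.sym_arcs by (simp add: symmetric_def ends)
    have sub: "arcs H \<subseteq> parcs G" "set zs \<subseteq> verts H" "parcs ?B \<subseteq> arcs H"
      using HG H(2) V by (auto simp: subgraph_def)
    show False
    proof (cases "verts H = set zs")
      case True
      have "arcs H \<subseteq> parcs ?B"
      proof (rule subrelI)
        fix a b assume ab: "(a, b) \<in> arcs H"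
        have "a \<in> set zs" "b \<in> set zs"
          using H.tail_in_verts[OF ab] H.head_in_verts[OF ab] True th by auto
        then obtain i j where ij: "i < length zs" "a = zs ! i" "j < length zs" "b = zs ! j"
          by (metis in_set_conv_nth)
        have E: "(a, b) \<in> parcs G" "(b, a) \<in> parcs G" using ab sub(1) arcs_symmetric by auto
        have *: "Suc k = l \<or> Suc l mod length zs = k"
          if "k < l" "l < length zs" "(zs ! k, zs ! l) \<in> parcs G" for k l
          using R.cycle_chordless[OF cyc that] by auto
        have "i \<noteq> j" using E ij R.irrefl_E by auto
        then consider "i < j" | "j < i" by linarith
        then show "(a, b) \<in> parcs ?B"
        proof cases
          case 1
          then show ?thesis using *[OF 1 ij(3)] E ij unfolding parcs_image_cycle_graph
            by (metis mod_less)
        next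
          case 2
          then show ?thesis using *[OF 2 ij(1)] E ij unfolding parcs_image_cycle_graph
            by (metis mod_less)
        qed
      qed
      then have "H = with_proj ?B"
        using sub(3) True V th by (intro pre_digraph.equality) auto
      then show False using H(1) by blast
    next
      case False
      then obtain w where w: "w \<in> verts H" "w \<notin> set zs" using sub(2) by blast
      have hd: "hd zs \<in> set zs" using zs by (cases zs) auto
      have "(w, hd zs) \<in> (arcs_ends H)\<^sup>*"
        using tc symH ends w(1) hd sub(2)
        by (intro connected_imp_rtrancl) (auto simp: two_connected_def)
      moreover have "\<exists>z'\<in>set zs - {v}. (w, z') \<in> {(a, b) \<in> arcs H. a \<noteq> v \<and> b \<noteq> v}\<^sup>*"
        if v: "v \<in> set zs" for v
      proof -
        have "\<not> set zs \<subseteq> {v}"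
          using card_mono[of "{v}" "set zs"] zs by (auto simp: distinct_card)
        then obtain z' where z': "z' \<in> set zs - {v}" by blast
        let ?D = "pre_digraph.del_vert H v"
        have e: "arcs_ends ?D = {(a, b) \<in> arcs H. a \<noteq> v \<and> b \<noteq> v}"
          by (auto simp: arcs_ends_conv pre_digraph.del_vert_def th)
        have "sym (arcs_ends ?D)" unfolding e using symH by (auto simp: sym_def)
        moreover have "connected ?D" using tc v sub(2) by (auto simp: two_connected_def)
        moreover have "w \<in> verts ?D" "z' \<in> verts ?D"
          using w z' v sub(2) by (auto simp: pre_digraph.del_vert_def)
        ultimately have "(w, z') \<in> (arcs_ends ?D)\<^sup>*" by (intro connected_imp_rtrancl)
        then show ?thesis using z' e by auto
      qed
      ultimately show False using R.cycle_separates[OF cyc sub(1) w(2) hd] ends by simp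
    qed
  qed
  have "pre_digraph.max_subgraph (with_proj G) two_connected (with_proj ?B)"
    unfolding pre_digraph.max_subgraph_def
    using subgraph_cycle_list[OF cyc] two_connected_cycle[OF zs] no by blast
  then show ?thesis by (simp add: is_block_def)
qed

text \<open>A block formed by a bridge has only two vertices, so a block isomorphic to the 5-cycle
  is a 2-connected subgraph and yields a cycle. Conversely, cycles of a cactus are blocks.\<close>

lemma C5_block_iff:
  assumes "cactus G"
  shows "(\<exists>B. is_block G B \<and> digraph_iso (with_proj B) (with_proj (cycle_graph 5))) \<longleftrightarrow>
    (\<exists>zs. cycle_list (parcs G) zs \<and> length zs = 5)"
proof
  interpret pair_graph G using assms by (simp add: cactus_def)
  interpret C: pair_graph "cycle_graph 5" by (rule pair_graph_cycle_graph) simp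
  have C5: "pverts (cycle_graph 5) = {..<5}" by (simp add: cycle_graph_def)
  {
    assume "\<exists>B. is_block G B \<and> digraph_iso (with_proj B) (with_proj (cycle_graph 5))"
    then obtain B where B: "is_block G B" "digraph_iso (with_proj B) (with_proj (cycle_graph 5))"
      by blast
    \<comment> \<open>At this point \<open>B\<close> is not known to be a subgraph; well-formedness
      is part of the isomorphism.\<close>
    have wf: "pair_wf_digraph B"
      using B(2) by (auto simp: digraph_iso_def pre_digraph.digraph_isomorphism_def wf_digraph_wp_iff)
    obtain zs where zs: "distinct zs" "length zs = 5" "B = image_graph zs (cycle_graph 5)"
      using B(2) digraph_iso_image_graph_iff[OF wf C.pair_wf_digraph C5] by blast
    have V: "pverts B = set zs" unfolding zs(3) by (rule pverts_image_cycle_graph) (rule zs(2))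
    have no2: "pverts B \<noteq> {u, v}" for u v
    proof
      assume "pverts B = {u, v}"
      then have "card (set zs) \<le> 2" using V card_insert_le_m1[of 2 "{v}" u] by simp
      then show False using zs by (simp add: distinct_card)
    qed
    have "B \<noteq> \<lparr>pverts = {u, v}, parcs = {(u, v), (v, u)}\<rparr>" for u v
      using no2[of u v] by (metis pair_pre_digraph.select_convs(1))
    then have "pre_digraph.max_subgraph (with_proj G) two_connected (with_proj B)"
      using B(1) unfolding is_block_def by blast
    then have "subgraph (with_proj B) (with_proj G)" by (simp add: pre_digraph.max_subgraph_def)
    then have "parcs B \<subseteq> parcs G" by (simp add: subgraph_pair_iff wf pair_wf_digraph)
    then show "\<exists>zs. cycle_list (parcs G) zs \<and> length zs = 5"
      using cycle_list_iff[OF sym_parcs zs(1)] zs by auto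
  next
    assume "\<exists>zs. cycle_list (parcs G) zs \<and> length zs = 5"
    then obtain zs where zs: "cycle_list (parcs G) zs" "length zs = 5" by blast
    have "digraph_iso (with_proj (image_graph zs (cycle_graph 5))) (with_proj (cycle_graph 5))"
      using digraph_iso_image_graph_iff[OF pair_wf_image_graph[OF C.pair_wf_digraph] C.pair_wf_digraph C5]
        zs by (auto simp: cycle_list_def)
    then show "\<exists>B. is_block G B \<and> digraph_iso (with_proj B) (with_proj (cycle_graph 5))"
      using cactus_cycle_is_block[OF assms zs(1)] zs(2) by auto
  }
qed

section \<open>The square of a cycle in terms of positions\<close>

locale cycle_pair_graph = pair_graph G for G :: "'a pair_pre_digraph" +
  fixes zs :: "'a list" and n :: nat
  assumes zs: "distinct zs" "length zs = n" "3 \<le> n" and G_eq: "G = image_graph zs (cycle_graph n)"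
begin

lemma verts_eq: "pverts G = set zs"
  unfolding G_eq by (rule pverts_image_cycle_graph[OF zs(2)])

lemma arc_nth_iff:
  assumes "i < n" "j < n"
  shows "(zs ! i, zs ! j) \<in> parcs G \<longleftrightarrow> j = Suc i mod n \<or> i = Suc j mod n"
proof -
  have "Suc k mod n < n" for k using zs by simp
  then have "zs ! i = zs ! (Suc k mod n) \<longleftrightarrow> i = Suc k mod n" "zs ! j = zs ! (Suc k mod n) \<longleftrightarrow> j = Suc k mod n" for k
    using assms zs by (metis nth_eq_iff_index_eq)+
  moreover have "zs ! i = zs ! k \<longleftrightarrow> i = k" "zs ! j = zs ! k \<longleftrightarrow> j = k" if "k < n" for k
    using assms zs that by (metis nth_eq_iff_index_eq)+
  ultimately have "(\<exists>k<n. (zs ! i = zs ! k \<and> zs ! j = zs ! (Suc k mod n)) \<or>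
      (zs ! j = zs ! k \<and> zs ! i = zs ! (Suc k mod n))) \<longleftrightarrow>
    (\<exists>k<n. (i = k \<and> j = Suc k mod n) \<or> (j = k \<and> i = Suc k mod n))"
    by (simp cong: conj_cong)
  also have "\<dots> \<longleftrightarrow> j = Suc i mod n \<or> i = Suc j mod n" using assms by auto
  finally show ?thesis unfolding G_eq parcs_image_cycle_graph .
qed

lemma Suc_mod_inj: "i < n \<Longrightarrow> j < n \<Longrightarrow> Suc i mod n = Suc j mod n \<Longrightarrow> i = j"
  by (cases "Suc i = n"; cases "Suc j = n") auto

lemma square_adj_nth:
  assumes "i < n" "j < n" "square_adj (parcs G) (pverts G) (zs ! i) (zs ! j)"
  shows "j = Suc i mod n \<or> j = (i + 2) mod n \<or> i = Suc j mod n \<or> i = (j + 2) mod n"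
proof (cases "(zs ! i, zs ! j) \<in> parcs G")
  case True
  then show ?thesis using arc_nth_iff[OF assms(1,2)] by blast
next
  case False
  then obtain z where z: "z \<in> pverts G" "(zs ! i, z) \<in> parcs G" "(z, zs ! j) \<in> parcs G"
    using assms(3) by (auto simp: square_adj_def)
  obtain l where l: "l < n" "z = zs ! l" using z(1) verts_eq zs(2) by (metis in_set_conv_nth)
  have il: "l = Suc i mod n \<or> i = Suc l mod n" using z(2) arc_nth_iff[OF assms(1) l(1)] l(2) by simp
  have lj: "j = Suc l mod n \<or> l = Suc j mod n" using z(3) arc_nth_iff[OF l(1) assms(2)] l(2) by simp
  have ne: "i \<noteq> j" using assms(3) by (auto simp: square_adj_def)
  have two: "Suc (Suc k mod n) mod n = (k + 2) mod n" for k by (simp add: mod_simps)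
  from il lj show ?thesis
  proof (elim disjE)
    assume "l = Suc i mod n" "j = Suc l mod n"
    then show ?thesis using two by simp
  next
    assume "l = Suc i mod n" "l = Suc j mod n"
    then show ?thesis using Suc_mod_inj assms(1,2) ne by metis
  next
    assume "i = Suc l mod n" "j = Suc l mod n"
    then show ?thesis using ne by simp
  next
    assume "i = Suc l mod n" "l = Suc j mod n"
    then show ?thesis using two by simp
  qed
qed

text \<open>Positions are reduced modulo n so that i may run over all numbers, as the argument about
  periods requires.\<close>

lemma square_adj_Suc:
  "square_adj (parcs G) (pverts G) (zs ! (i mod n)) (zs ! (Suc i mod n))"
  "square_adj (parcs G) (pverts G) (zs ! (i mod n)) (zs ! ((i + 2) mod n))"
proof -
  have lt: "k mod n < n" for k using zs by simp
  have arc: "(zs ! (k mod n), zs ! (Suc k mod n)) \<in> parcs G" for k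
    using arc_nth_iff[OF lt[of k] lt[of "Suc k"]] by (simp add: mod_simps)
  have ne: "i mod n \<noteq> Suc i mod n" "i mod n \<noteq> (i + 2) mod n"
  proof -
    have "\<not> n dvd 1" "\<not> n dvd 2" using zs(3) by (auto dest: dvd_imp_le)
    then show "i mod n \<noteq> Suc i mod n" "i mod n \<noteq> (i + 2) mod n"
      using mod_eq_dvd_iff_nat[of i "Suc i" n] mod_eq_dvd_iff_nat[of i "i + 2" n] by fastforce+
  qed
  have "zs ! (i mod n) \<noteq> zs ! (Suc i mod n)" "zs ! (i mod n) \<noteq> zs ! ((i + 2) mod n)"
    using ne lt zs by (simp_all add: nth_eq_iff_index_eq)
  moreover have "zs ! (Suc i mod n) \<in> pverts G" using verts_eq zs(2) lt by simp
  ultimately show "square_adj (parcs G) (pverts G) (zs ! (i mod n)) (zs ! (Suc i mod n))"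
    "square_adj (parcs G) (pverts G) (zs ! (i mod n)) (zs ! ((i + 2) mod n))"
    using arc[of i] arc[of "Suc i"] unfolding square_adj_def by auto
qed

lemma degree_le_2: "v \<in> pverts G \<Longrightarrow> card {u. (v, u) \<in> parcs G} \<le> 2"
proof -
  assume "v \<in> pverts G"
  then obtain i where i: "i < n" "v = zs ! i" using verts_eq zs(2) by (metis in_set_conv_nth)
  define p where "p = (if i = 0 then n - 1 else i - 1)"
  have p: "p < n" "Suc p mod n = i" using i zs by (auto simp: p_def)
  have "{u. (v, u) \<in> parcs G} \<subseteq> {zs ! (Suc i mod n), zs ! p}"
  proof
    fix u assume "u \<in> {u. (v, u) \<in> parcs G}"
    then have u: "(v, u) \<in> parcs G" by simp
    then have "u \<in> set zs" using in_arcsD2 verts_eq by blast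
    then obtain j where j: "j < n" "u = zs ! j" using zs(2) by (metis in_set_conv_nth)
    then have "j = Suc i mod n \<or> i = Suc j mod n" using u i arc_nth_iff by blast
    moreover have "j = p" if "i = Suc j mod n" using Suc_mod_inj[OF j(1) p(1)] p(2) that by metis
    ultimately show "u \<in> {zs ! (Suc i mod n), zs ! p}" using j by blast
  qed
  then have "card {u. (v, u) \<in> parcs G} \<le> card {zs ! (Suc i mod n), zs ! p}" by (intro card_mono) auto
  also have "\<dots> \<le> 2" by (simp add: card_insert_if)
  finally show ?thesis .
qed

lemma cycle_list_zs: "cycle_list (parcs G) zs"
  using cycle_list_iff[OF sym_parcs zs(1)] zs(2,3) G_eq by simp

lemma choosable_3: "3 dvd n \<Longrightarrow> choosable (square G) 3"
proof (rule choosable_squareI)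
  fix L :: "'a \<Rightarrow> nat set"
  assume n: "3 dvd n" and L: "\<And>v. v \<in> pverts G \<Longrightarrow> 3 \<le> card (L v)"
  have "3 \<le> card (L (zs ! i))" if "i < n" for i using L verts_eq zs(2) that by simp
  then obtain d where d: "\<forall>i<n. d i \<in> L (zs ! i) \<and> d i \<noteq> d (Suc i mod n) \<and> d i \<noteq> d ((i + 2) mod n)"
    using cycle_square_3_choosable[OF zs(3) n, of "\<lambda>i. L (zs ! i)"] by blast
  define c where "c = d \<circ> inv_into {..<n} ((!) zs)"
  have c: "c (zs ! i) = d i" if "i < n" for i
  proof -
    have "inv_into {..<n} ((!) zs) (zs ! i) = i"
      using that zs by (intro inv_into_f_f inj_on_nth) auto
    then show ?thesis by (simp add: c_def)
  qed
  have "square_coloring (parcs G) (pverts G) L c"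
    unfolding square_coloring_def
  proof (intro conjI ballI impI)
    fix v assume "v \<in> pverts G"
    then obtain i where "i < n" "v = zs ! i" using verts_eq zs(2) by (metis in_set_conv_nth)
    then show "c v \<in> L v" using c d by simp
  next
    fix u v assume uv: "u \<in> pverts G" "v \<in> pverts G" "square_adj (parcs G) (pverts G) u v"
    obtain i where i: "i < n" "u = zs ! i" using uv(1) verts_eq zs(2) by (metis in_set_conv_nth)
    obtain j where j: "j < n" "v = zs ! j" using uv(2) verts_eq zs(2) by (metis in_set_conv_nth)
    have "d i \<noteq> d j"
      using square_adj_nth[OF i(1) j(1)] uv(3) i j d by metis
    then show "c u \<noteq> c v" using c i j by simp
  qed
  then show "\<exists>c. square_coloring (parcs G) (pverts G) L c" by blast
qed

lemma not_3_colorable: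
  fixes k :: nat
  assumes c: "square_coloring (parcs G) (pverts G) (\<lambda>_. {..<k}) c" and n: "\<not> 3 dvd n"
  shows "4 \<le> k"
proof (rule ccontr)
  assume "\<not> 4 \<le> k"
  then have k: "k \<le> 3" by simp
  define f where "f i = c (zs ! (i mod n))" for i
  have V: "zs ! (i mod n) \<in> pverts G" for i using verts_eq zs by simp
  have lt: "f i < 3" for i using c V[of i] k unfolding square_coloring_def f_def by fastforce
  have ne: "f i \<noteq> f (Suc i)" "f i \<noteq> f (i + 2)" for i
    using c V square_adj_Suc[of i] unfolding square_coloring_def f_def by blast+
  have "f (i + 3) = f i" for i
  proof -
    \<comment> \<open>Positions i and i + 3 both avoid the two distinct colors at i + 1 and i + 2,
      so three colors leave them the same value.\<close>
    have "f (i + 1) \<noteq> f (i + 2)" "f (i + 1) \<noteq> f (i + 3)" "f (i + 2) \<noteq> f (i + 3)"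
      using ne[of "i + 1"] ne[of "i + 2"] by (simp_all add: numeral_eq_Suc)
    then show ?thesis using ne[of i] lt[of i] lt[of "i + 1"] lt[of "i + 2"] lt[of "i + 3"] by auto
  qed
  note step = this
  have per: "f (3 * m + r) = f r" for m r
  proof (induction m)
    case (Suc m)
    have "3 * Suc m + r = 3 * m + r + 3" by simp
    then show ?case using step[of "3 * m + r"] Suc by (simp only:)
  qed simp
  \<comment> \<open>Since \<open>f\<close> also has period n, its value at \<open>n mod 3\<close> is
    \<open>f 0\<close>, which differs from \<open>f 1\<close> and \<open>f 2\<close>.\<close>
  have "f n = f 0" by (simp add: f_def)
  then have "f (n mod 3) = f 0" using per[of "n div 3" "n mod 3"] by simp
  moreover have "n mod 3 = 1 \<or> n mod 3 = 2" using n by presburger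
  moreover have "f 0 \<noteq> f 1" "f 0 \<noteq> f 2" using ne[of 0] by (simp_all add: numeral_2_eq_2)
  ultimately show False by metis
qed

lemma three_le_colors:
  fixes k :: nat
  assumes "square_coloring (parcs G) (pverts G) (\<lambda>_. {..<k}) c"
  shows "3 \<le> k"
proof -
  have V: "zs ! i \<in> pverts G" if "i < n" for i using verts_eq zs that by simp
  have "square_adj (parcs G) (pverts G) (zs ! 0) (zs ! 1)"
    "square_adj (parcs G) (pverts G) (zs ! 0) (zs ! 2)"
    "square_adj (parcs G) (pverts G) (zs ! 1) (zs ! 2)"
    using square_adj_Suc[of 0] square_adj_Suc[of 1] zs(3) by (simp_all add: numeral_2_eq_2)
  moreover have "zs ! 0 \<in> pverts G" "zs ! 1 \<in> pverts G" "zs ! 2 \<in> pverts G" using V zs(3) by auto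
  ultimately have "c (zs ! 0) \<noteq> c (zs ! 1)" "c (zs ! 0) \<noteq> c (zs ! 2)" "c (zs ! 1) \<noteq> c (zs ! 2)"
    "c (zs ! 0) < k" "c (zs ! 1) < k" "c (zs ! 2) < k"
    using assms unfolding square_coloring_def by blast+
  then show ?thesis by linarith
qed

end

text \<open>Adjacent vertices of the square have positions differing by 1 or 2, so positions modulo
  3 serve as colors, and no degrees of a path have to be computed.\<close>

lemma path_graph_square_3_colorable:
  assumes G: "pair_graph G" and xs: "distinct xs" "length xs = n" "G = image_graph xs (path_graph n)"
  shows "colorable (square G) 3"
proof -
  interpret pair_graph G by fact
  define c where "c v = inv_into {..<n} ((!) xs) v mod 3" for v
  have inv: "inv_into {..<n} ((!) xs) (xs ! i) = i" if "i < n" for i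
    using that xs by (intro inv_into_f_f inj_on_nth) auto
  have arc: "\<exists>i j. i < n \<and> j < n \<and> u = xs ! i \<and> v = xs ! j \<and> (j = Suc i \<or> i = Suc j)"
    if "(u, v) \<in> parcs G" for u v
    using that unfolding xs(3) parcs_image_graph_iff by (auto simp: path_graph_def)
  have arc': "inv_into {..<n} ((!) xs) v = Suc (inv_into {..<n} ((!) xs) u) \<or>
      inv_into {..<n} ((!) xs) u = Suc (inv_into {..<n} ((!) xs) v)"
    if "(u, v) \<in> parcs G" for u v
    using arc[OF that] inv by auto
  have inj: "u = v" if "u \<in> pverts G" "v \<in> pverts G"
    "inv_into {..<n} ((!) xs) u = inv_into {..<n} ((!) xs) v" for u v
  proof -
    have "pverts G = (!) xs ` {..<n}" unfolding xs(3) by (simp add: image_graph_def path_graph_def)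
    then show ?thesis using that by (metis inv_into_injective)
  qed
  have mod3: "i mod 3 \<noteq> j mod 3" if "j = i + 1 \<or> i = j + 1 \<or> j = i + 2 \<or> i = j + 2" for i j :: nat
  proof -
    have "(k + 1) mod 3 \<noteq> k mod 3" "(k + 2) mod 3 \<noteq> k mod 3" for k :: nat by presburger+
    then show ?thesis using that by metis
  qed
  have "square_coloring (parcs G) (pverts G) (\<lambda>_. {..<3}) c"
    unfolding square_coloring_def
  proof (intro conjI ballI impI)
    fix v show "c v \<in> {..<3}" by (simp add: c_def)
  next
    fix u v assume uv: "u \<in> pverts G" "v \<in> pverts G" "square_adj (parcs G) (pverts G) u v"
    let ?i = "inv_into {..<n} ((!) xs)"
    have "?i u \<noteq> ?i v" using inj uv by (auto simp: square_adj_def)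
    moreover have "?i v = Suc (?i u) \<or> ?i u = Suc (?i v) \<or>
      (\<exists>l. (l = Suc (?i u) \<or> ?i u = Suc l) \<and> (?i v = Suc l \<or> l = Suc (?i v)))"
      using uv(3) arc' unfolding square_adj_def by blast
    ultimately have "?i v = ?i u + 1 \<or> ?i u = ?i v + 1 \<or> ?i v = ?i u + 2 \<or> ?i u = ?i v + 2"
      by (elim disjE exE conjE) simp_all
    then show "c u \<noteq> c v" unfolding c_def by (rule mod3)
  qed
  then show ?thesis using colorable_square_iff by blast
qed

section \<open>The choice number of the square of a cactus\<close>

lemma (in pair_graph) max_degree_ge: "v \<in> pverts G \<Longrightarrow> card {u. (v, u) \<in> parcs G} \<le> max_degree G"
  unfolding max_degree_def degree_eq[symmetric] using pair_finite_verts by (intro Max_ge) auto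

lemma (in pair_graph) max_degree_attained:
  assumes "pverts G \<noteq> {}"
  obtains v where "v \<in> pverts G" "card {u. (v, u) \<in> parcs G} = max_degree G"
proof -
  have "max_degree G \<in> out_degree G ` pverts G"
    unfolding max_degree_def using pair_finite_verts assms by (intro Max_in) auto
  then show thesis using that degree_eq by auto
qed

context
  fixes G :: "'a pair_pre_digraph"
  assumes cactus: "cactus G"
begin

interpretation pair_graph G using cactus by (simp add: cactus_def)
interpretation R: cactus_relation "pverts G" "parcs G" by (rule cactus_imp_cactus_relation[OF cactus])

lemma cactus_nonempty: "pverts G \<noteq> {}"
  using cactus by (auto simp: cactus_def connected_def strongly_connected_def mk_symmetric_def)

lemma max_degree_less_colors:
  assumes "colorable (square G) k"
  shows "max_degree G + 1 \<le> k"
proof -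
  obtain c where c: "square_coloring (parcs G) (pverts G) (\<lambda>_. {..<k}) c"
    using assms colorable_square_iff by blast
  obtain v where v: "v \<in> pverts G" "card {u. (v, u) \<in> parcs G} = max_degree G"
    using max_degree_attained[OF cactus_nonempty] by blast
  show ?thesis using R.square_coloring_degree[OF c v(1)] v(2) by simp
qed

lemma C5_colors:
  assumes "colorable (square G) k" "cycle_list (parcs G) zs" "length zs = 5"
  shows "5 \<le> k"
  using assms R.square_coloring_C5 colorable_square_iff by blast

lemma cactus_choosable:
  assumes "max_degree G < k"
    and "\<And>zs. cycle_list (parcs G) zs \<Longrightarrow> 4 \<le> k \<and> (5 \<le> k \<or> length zs \<noteq> 5)"
  shows "choosable (square G) k"
proof (rule choosable_squareI)
  fix L :: "'a \<Rightarrow> nat set"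
  assume L: "\<And>v. v \<in> pverts G \<Longrightarrow> k \<le> card (L v)"
  have "card {u. (v, u) \<in> parcs G} < k" if "v \<in> pverts G" for v
    using max_degree_ge[OF that] assms(1) by simp
  then show "\<exists>c. square_coloring (parcs G) (pverts G) L c"
    using R.cactus_square_choosable L assms(2) by blast
qed

lemma choice_chromatic_large_degree:
  assumes "4 \<le> max_degree G"
  shows "choice_number (square G) = max_degree G + 1" "chromatic_number (square G) = max_degree G + 1"
proof -
  have "choosable (square G) (max_degree G + 1)" using assms by (intro cactus_choosable) auto
  then show "choice_number (square G) = max_degree G + 1"
    "chromatic_number (square G) = max_degree G + 1"
    using choice_chromatic_eqI max_degree_less_colors by blast+
qed

lemma choice_chromatic_degree_3:
  assumes "max_degree G = 3"
  defines "k \<equiv> if \<exists>zs. cycle_list (parcs G) zs \<and> length zs = 5 then 5 else 4"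
  shows "choice_number (square G) = k" "chromatic_number (square G) = k"
proof -
  have "choosable (square G) k" using assms(1) by (intro cactus_choosable) (auto simp: k_def)
  moreover have "k \<le> l" if "colorable (square G) l" for l
    using max_degree_less_colors[OF that] C5_colors[OF that] assms(1) by (auto simp: k_def)
  ultimately show "choice_number (square G) = k" "chromatic_number (square G) = k"
    using choice_chromatic_eqI by blast+
qed

lemma choice_chromatic_cycle:
  assumes iso: "digraph_iso (with_proj G) (with_proj (cycle_graph n))" and n: "3 \<le> n"
  defines "k \<equiv> if 3 dvd n then 3 else if n = 5 then 5 else 4"
  shows "choice_number (square G) = k" "chromatic_number (square G) = k"
proof -
  interpret C: pair_graph "cycle_graph n" by (rule pair_graph_cycle_graph) (use n in simp)
  obtain zs where "distinct zs" "length zs = n" "G = image_graph zs (cycle_graph n)"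
    using iso digraph_iso_image_graph_iff[OF pair_wf_digraph C.pair_wf_digraph, of n]
    by (auto simp: cycle_graph_def)
  then interpret Z: cycle_pair_graph G zs n by unfold_locales (use n in auto)
  have deg: "max_degree G \<le> 2"
    using max_degree_attained[OF cactus_nonempty] Z.degree_le_2 by metis
  \<comment> \<open>Degree at most 2 makes every cycle spanning, so all cycles have length n and the
    condition on cycles of length 5 turns into one on n.\<close>
  have len: "length ys = n" if ys: "cycle_list (parcs G) ys" for ys
  proof -
    have "distinct ys" using ys by (simp add: cycle_list_def)
    moreover have "set ys = set zs" using R.cycle_list_spanning[OF Z.degree_le_2 ys] Z.verts_eq by simp
    ultimately show ?thesis using Z.zs(1,2) by (metis distinct_card)
  qed
  have "choosable (square G) k"
  proof (cases "3 dvd n")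
    case True
    then show ?thesis using Z.choosable_3 by (simp add: k_def)
  next
    case False
    then show ?thesis using len deg by (intro cactus_choosable) (auto simp: k_def)
  qed
  moreover have "k \<le> l" if l: "colorable (square G) l" for l
  proof -
    obtain c where c: "square_coloring (parcs G) (pverts G) (\<lambda>_. {..<l}) c"
      using l colorable_square_iff by blast
    show ?thesis
      using Z.three_le_colors[OF c] Z.not_3_colorable[OF c] C5_colors[OF l Z.cycle_list_zs] Z.zs(2)
      by (auto simp: k_def)
  qed
  ultimately show "choice_number (square G) = k" "chromatic_number (square G) = k"
    using choice_chromatic_eqI by blast+
qed

text \<open>For a path both numbers equal \<open>max_degree G + 1\<close>: there are no cycles, so
  the degree bound alone governs the growth, and closed neighborhoods need as many colors. For a
  cycle the number of vertices is recorded as its length, ready for the formula for cycles.\<close>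

lemma small_degree_cases:
  assumes "max_degree G \<le> 2"
  obtains (path) "is_path G" "choice_number (square G) = chromatic_number (square G)"
  | (cycle) "digraph_iso (with_proj G) (with_proj (cycle_graph (card (pverts G))))"
    "3 \<le> card (pverts G)"
proof -
  have deg: "card {u. (v, u) \<in> parcs G} \<le> 2" if "v \<in> pverts G" for v
    using max_degree_ge[OF that] assms by simp
  have arcs_V: "a \<in> pverts G \<and> b \<in> pverts G" if "(a, b) \<in> parcs G" for a b
    using that in_arcsD1 in_arcsD2 by blast
  from R.max_degree_2_cases[OF deg cactus_nonempty] show thesis
  proof
    assume "\<exists>xs. R.induced_path xs \<and> set xs = pverts G"
    then obtain xs where xs: "R.induced_path xs" "set xs = pverts G" by blast
    let ?n = "length xs"
    have d: "distinct xs" "xs \<noteq> []" "walk_list (parcs G) xs"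
      using xs(1) by (auto simp: R.induced_path_def)
    have "parcs G = parcs (image_graph xs (path_graph ?n))"
    proof (rule set_eqI, clarify)
      fix a b
      have *: "l = Suc k" if "k < l" "l < ?n" "(xs ! k, xs ! l) \<in> parcs G" for k l
        using R.induced_path_arcs[OF xs(1) that] .
      have w: "(xs ! k, xs ! Suc k) \<in> parcs G" if "Suc k < ?n" for k
        using d(3) that unfolding walk_list_nth by blast
      have "(a, b) \<in> parcs G \<longleftrightarrow>
        (\<exists>i j. i < ?n \<and> j < ?n \<and> (j = Suc i \<or> i = Suc j) \<and> a = xs ! i \<and> b = xs ! j)"
      proof
        assume ab: "(a, b) \<in> parcs G"
        then have "a \<in> set xs" "b \<in> set xs" using arcs_V xs(2) by auto
        then obtain i j where ij: "i < ?n" "a = xs ! i" "j < ?n" "b = xs ! j"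
          by (metis in_set_conv_nth)
        have "i \<noteq> j" using ab ij R.irrefl_E by auto
        then have "j = Suc i \<or> i = Suc j"
          using *[of i j] *[of j i] ab ij arcs_symmetric[OF ab] by (meson linorder_neqE_nat)
        then show "\<exists>i j. i < ?n \<and> j < ?n \<and> (j = Suc i \<or> i = Suc j) \<and> a = xs ! i \<and> b = xs ! j"
          using ij by blast
      next
        assume "\<exists>i j. i < ?n \<and> j < ?n \<and> (j = Suc i \<or> i = Suc j) \<and> a = xs ! i \<and> b = xs ! j"
        then show "(a, b) \<in> parcs G" using w arcs_symmetric by blast
      qed
      also have "\<dots> \<longleftrightarrow> (a, b) \<in> parcs (image_graph xs (path_graph ?n))"
        unfolding parcs_image_graph_iff by (auto simp: path_graph_def)
      finally show "(a, b) \<in> parcs G \<longleftrightarrow> (a, b) \<in> parcs (image_graph xs (path_graph ?n))" .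
    qed
    moreover have "pverts G = pverts (image_graph xs (path_graph ?n))"
      unfolding xs(2)[symmetric] by (auto simp: image_graph_def path_graph_def in_set_conv_nth)
    ultimately have "G = image_graph xs (path_graph ?n)" by simp
    then have "digraph_iso (with_proj G) (with_proj (path_graph ?n))"
      using d(1) digraph_iso_image_graph_iff[OF pair_wf_digraph pair_wf_path_graph, of ?n ?n]
      by (auto simp: path_graph_def)
    moreover have "1 \<le> ?n" using d(2) by (cases xs) auto
    ultimately have path: "is_path G" unfolding is_path_def by blast
    have "choosable (square G) (max_degree G + 1)"
      using R.spanning_induced_path_no_cycle[OF xs deg] by (intro cactus_choosable) auto
    then have "choice_number (square G) = max_degree G + 1"
      "chromatic_number (square G) = max_degree G + 1"
      using choice_chromatic_eqI max_degree_less_colors by blast+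
    then show thesis using path that(1) by simp
  next
    assume "\<exists>zs. cycle_list (parcs G) zs \<and> set zs = pverts G"
    then obtain zs where zs: "cycle_list (parcs G) zs" "set zs = pverts G" by blast
    let ?n = "length zs"
    have d: "distinct zs" "3 \<le> ?n" using zs(1) by (auto simp: cycle_list_def)
    interpret C: pair_graph "cycle_graph ?n" by (rule pair_graph_cycle_graph) (use d in simp)
    have "parcs G = parcs (image_graph zs (cycle_graph ?n))"
    proof
      show "parcs (image_graph zs (cycle_graph ?n)) \<subseteq> parcs G"
        using cycle_list_iff[OF sym_parcs d] zs(1) by simp
      show "parcs G \<subseteq> parcs (image_graph zs (cycle_graph ?n))"
      proof (rule subrelI)
        fix a b assume ab: "(a, b) \<in> parcs G"
        then have "a \<in> set zs" "b \<in> set zs" using arcs_V zs(2) by auto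
        then obtain i j where ij: "i < ?n" "a = zs ! i" "j < ?n" "b = zs ! j"
          by (metis in_set_conv_nth)
        have *: "(zs ! k, zs ! l) \<in> parcs (image_graph zs (cycle_graph ?n)) \<and>
            (zs ! l, zs ! k) \<in> parcs (image_graph zs (cycle_graph ?n))"
          if "k < l" "l < ?n" "(zs ! k, zs ! l) \<in> parcs G" for k l
        proof -
          \<comment> \<open>The exception allowed by \<open>cycle_chordless\<close>, first and last
            position, is the second alternative: the successor of the last position is 0.\<close>
          have "l = Suc k mod ?n \<or> k = Suc l mod ?n"
            using R.cycle_chordless[OF zs(1) that] that by auto
          then show ?thesis using that unfolding parcs_image_cycle_graph
            by (metis order.strict_trans)
        qed
        have "i \<noteq> j" using ab ij R.irrefl_E by auto
        then show "(a, b) \<in> parcs (image_graph zs (cycle_graph ?n))"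
          using *[of i j] *[of j i] ab ij arcs_symmetric[OF ab] by (meson linorder_neqE_nat)
      qed
    qed
    moreover have "pverts G = pverts (image_graph zs (cycle_graph ?n))"
      using zs(2) pverts_image_cycle_graph[of zs ?n] by simp
    ultimately have "G = image_graph zs (cycle_graph ?n)" by simp
    then have "digraph_iso (with_proj G) (with_proj (cycle_graph ?n))"
      using d(1) digraph_iso_image_graph_iff[OF pair_wf_digraph C.pair_wf_digraph, of ?n]
      by (auto simp: cycle_graph_def)
    moreover have "card (pverts G) = ?n" using d(1) zs(2) by (metis distinct_card)
    ultimately show thesis using d(2) that(2) by simp
  qed
qed

lemma chromatic_path_le_3:
  assumes "is_path G"
  shows "chromatic_number (square G) \<le> 3"
proof -
  obtain n where n: "digraph_iso (with_proj G) (with_proj (path_graph n))"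
    using assms by (auto simp: is_path_def)
  then obtain xs where "distinct xs" "length xs = n" "G = image_graph xs (path_graph n)"
    using digraph_iso_image_graph_iff[OF pair_wf_digraph pair_wf_path_graph, of n n]
    by (auto simp: path_graph_def)
  then have "colorable (square G) 3" using path_graph_square_3_colorable[OF pair_graph] by blast
  then show ?thesis unfolding chromatic_number_def by (rule Least_le)
qed

end

theorem theorem2:
  fixes G :: "'a pair_pre_digraph" and n :: nat
  assumes "cactus G" and "n = card (pverts G)"
  shows "choice_number (square G) = chromatic_number (square G) \<and>
    (max_degree G \<ge> 4 \<longrightarrow> chromatic_number (square G) = max_degree G + 1) \<and>
    (max_degree G = 3 \<longrightarrow>
       (\<not> (\<exists>B. is_block G B \<and> digraph_iso B (cycle_graph 5)) \<longrightarrow>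
          chromatic_number (square G) = 4) \<and>
       ((\<exists>B. is_block G B \<and> digraph_iso B (cycle_graph 5)) \<longrightarrow>
          chromatic_number (square G) = 5)) \<and>
    (max_degree G \<le> 2 \<longrightarrow>
       (is_path G \<or> is_cycle G) \<and>
       (is_path G \<longrightarrow> chromatic_number (square G) \<le> 3) \<and>
       (n \<ge> 3 \<and> digraph_iso G (cycle_graph n) \<longrightarrow>
          chromatic_number (square G) = (if 3 dvd n then 3 else if n = 5 then 5 else 4)))"
proof -
  consider "4 \<le> max_degree G" | "max_degree G = 3" | "max_degree G \<le> 2" by linarith
  then show ?thesis
  proof cases
    case 1
    then show ?thesis using choice_chromatic_large_degree[OF assms(1)] by simp
  next
    case 2
    then show ?thesis
      unfolding C5_block_iff[OF assms(1)] using choice_chromatic_degree_3[OF assms(1)] by auto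
  next
    case 3
    have eq: "choice_number (square G) = chromatic_number (square G) \<and> (is_path G \<or> is_cycle G)"
      using assms(1) 3
    proof (cases rule: small_degree_cases)
      case path
      then show ?thesis by simp
    next
      case cycle
      then show ?thesis
        using choice_chromatic_cycle[OF assms(1) cycle] unfolding is_cycle_def by auto
    qed
    show ?thesis
      using eq 3 chromatic_path_le_3[OF assms(1)] choice_chromatic_cycle(2)[OF assms(1), of n] by simp
  qed
qed

end
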